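(* Let $\varepsilon\in\{\pm1\}$ and let $\nu,\tau,\omega\in\mathbb Z[\widehat I]$ be such that $\tau+\omega=\nu$. Then $$\Delta^\nu_{\tau,\omega,I}\circ\Psi_\varepsilon|_\nu=(\Psi_\varepsilon|_\tau\otimes\Psi_\varepsilon|_\omega)\circ\Delta^\nu_{\tau,\omega,\widehat I}.$$
   Context: A Cartan datum $(I,\cdot)$ is a finite set $I$ with a $\mathbb Z$-valued symmetric bilinear form $\cdot$ on $\mathbb Z[I]$ such that $i\cdot i\in\{2,4,6,\dots\}$ and $2\frac{i\cdot j}{i\cdot i}\in\{0,-1,-2,\dots\}$ for $i\neq j$ in $I$. Fix $i_+,i_-\in I$ with $i_+\cdot i_+=i_-\cdot i_-=-2\,i_+\cdot i_-$. Put $i_0=i_++i_-\in\mathbb Z[I]$, $\widehat I=(I\setminus\{i_+,i_-\})\cup\{i_0\}$, so $\mathbb Z[\widehat I]\subset\mathbb Z[I]$; with the restricted form $(\widehat I,\cdot)$ is a Cartan datum (the edge contraction). A root datum of type $(I,\cdot)$: finitely generated free abelian groups $Y,X$, a perfect pairing $\langle\,,\rangle:Y\times X\to\mathbb Z$, embeddings $I\hookrightarrow Y$, $i\mapsto i$, $I\hookrightarrow X$, $i\mapsto i'$, with $\langle i,j'\rangle=2\frac{i\cdot j}{i\cdot i}$. Fix one; the same $Y,X$ with $i_0\mapsto i_++i_-\in Y$, $i_0'=i_+'+i_-'\in X$ is a root datum of type $(\widehat I,\cdot)$. Let $v$ be an indeterminate, $v_i=v^{i\cdot i/2}$, $[n]_i=\frac{v_i^n-v_i^{-n}}{v_i-v_i^{-1}}$,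 $x_i^{(n)}=x_i^n/[n]_i^!$. $\mathbf U_I$ is the $\mathbb Q(v)$-algebra with generators $E_i,F_i$ ($i\in I$), $K_\mu$ ($\mu\in Y$) and relations $K_0=1$, $K_\mu K_{\mu'}=K_{\mu+\mu'}$, $K_\mu E_i=v^{\langle\mu,i'\rangle}E_iK_\mu$, $K_\mu F_i=v^{-\langle\mu,i'\rangle}F_iK_\mu$, $E_iF_j-F_jE_i=\delta_{ij}\frac{\tilde K_i-\tilde K_i^{-1}}{v_i-v_i^{-1}}$ with $\tilde K_i=K_{\frac{i\cdot i}{2}i}$, and $\sum_{r+s=1-\langle i,j'\rangle}(-1)^rx_i^{(s)}x_jx_i^{(r)}=0$ for $x=E,F$, $i\neq j$. Comultiplication: the algebra homomorphism $\Delta_I:\mathbf U_I\to\mathbf U_I\otimes\mathbf U_I$ with $\Delta(E_i)=E_i\otimes1+\tilde K_i\otimes E_i$, $\Delta(F_i)=F_i\otimes\tilde K_i^{-1}+1\otimes F_i$, $\Delta(K_\mu)=K_\mu\otimes K_\mu$. $\mathbf U_{\widehat I}$ is defined likewise for $(\widehat I,\cdot)$ with the root datum above; generators $\widehat E_i,\widehat F_i,\widehat K_\mu$. $\mathbf U_I=\bigoplus_{\nu\in\mathbb Z[I]}\mathbf U_I(\nu)$ is the grading with $E_i$ of degree $i$, $F_i$ of degree $-i$, $K_\mu$ of degree $0$. For $\nu=\tau+\omega$, $\Delta^\nu_{\tau,\omega,I}:\mathbf U_I(\nu)\to\mathbf U_I(\tau)\otimes\mathbf U_I(\omega)$ is $\Delta_I$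 restricted to $\mathbf U_I(\nu)$ followed by projection to the component $\mathbf U_I(\tau)\otimes\mathbf U_I(\omega)$; $\Delta^\nu_{\tau,\omega,\widehat I}$ is the analogue for $\mathbf U_{\widehat I}=\bigoplus_{\nu\in\mathbb Z[\widehat I]}\mathbf U_{\widehat I}(\nu)$. $\Psi_\varepsilon:\mathbf U_{\widehat I}\to\mathbf U_I$ is the algebra embedding $\widehat E_i\mapsto E_i$, $\widehat F_i\mapsto F_i$ ($i\ne i_0$), $\widehat K_\mu\mapsto K_\mu$, $\widehat E_{i_0}\mapsto E_{i_+}E_{i_-}-v_{i_0}^{-\varepsilon}E_{i_-}E_{i_+}$, $\widehat F_{i_0}\mapsto F_{i_-}F_{i_+}-v_{i_0}^{\varepsilon}F_{i_+}F_{i_-}$; it preserves degrees and $\Psi_\varepsilon|_\nu:\mathbf U_{\widehat I}(\nu)\to\mathbf U_I(\nu)$ is its restriction. *)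

theory Defs
  imports
    "HOL-Algebra.Free_Abelian_Groups"
    "HOL-Algebra.QuotRing"
    "HOL-Algebra.Module"
    "HOL-Computational_Algebra.Polynomial"
    "HOL-Computational_Algebra.Fraction_Field"
begin

section \<open>Cartan data, root data and edge contraction\<close>

abbreviation int_span :: "'j set \<Rightarrow> ('j \<Rightarrow>\<^sub>0 int) set" where
  "int_span J \<equiv> carrier (free_Abelian_group J)"

definition cartan_datum :: "'j set \<Rightarrow> (('j \<Rightarrow>\<^sub>0 int) \<Rightarrow> ('j \<Rightarrow>\<^sub>0 int) \<Rightarrow> int) \<Rightarrow> bool" where
  "cartan_datum J form \<longleftrightarrow>
     finite J \<and>
     (\<forall>x\<in>int_span J. \<forall>y\<in>int_span J. form x y = form y x) \<and>
     (\<forall>x\<in>int_span J. \<forall>y\<in>int_span J. \<forall>z\<in>int_span J. form (x + y) z = form x z + form y z) \<and>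
     (\<forall>i\<in>J. form (frag_of i) (frag_of i) > 0 \<and> even (form (frag_of i) (frag_of i))) \<and>
     (\<forall>i\<in>J. \<forall>j\<in>J. i \<noteq> j \<longrightarrow>
        (\<exists>n::nat. 2 * of_int (form (frag_of i) (frag_of j)) / of_int (form (frag_of i) (frag_of i))
                    = - (of_nat n :: rat)))"

definition fg_free_abelian :: "'a::ab_group_add itself \<Rightarrow> bool" where
  "fg_free_abelian _ \<longleftrightarrow>
     (\<exists>(n::nat) (f :: 'a \<Rightarrow> (nat \<Rightarrow>\<^sub>0 int)). additive f \<and> bij_betw f UNIV (int_span {..<n}))"

definition perfect_pairing :: "('y::ab_group_add \<Rightarrow> 'x::ab_group_add \<Rightarrow> int) \<Rightarrow> bool" where
  "perfect_pairing b \<longleftrightarrow>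
     (\<forall>y. additive (b y)) \<and> (\<forall>x. additive (\<lambda>y. b y x)) \<and>
     (\<forall>f. additive f \<longrightarrow> (\<exists>!y. f = b y)) \<and>
     (\<forall>f. additive f \<longrightarrow> (\<exists>!x. f = (\<lambda>y. b y x)))"

text \<open>The lattices \<open>Y\<close> and \<open>X\<close> are the types \<open>'y\<close> and \<open>'x\<close>.  The coroot of \<open>i\<close> is the
  element \<open>i\<close> of \<open>Y\<close>, the root of \<open>i\<close> is the element \<open>i'\<close> of \<open>X\<close>.\<close>

record ('j, 'y, 'x) datum =
  idx :: "'j set"
  form :: "('j \<Rightarrow>\<^sub>0 int) \<Rightarrow> ('j \<Rightarrow>\<^sub>0 int) \<Rightarrow> int"
  pairing :: "'y \<Rightarrow> 'x \<Rightarrow> int"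
  coroot :: "'j \<Rightarrow> 'y"
  simple_root :: "'j \<Rightarrow> 'x"

definition dot :: "('j, 'y, 'x) datum \<Rightarrow> 'j \<Rightarrow> 'j \<Rightarrow> int" where
  "dot D i j = form D (frag_of i) (frag_of j)"

definition root_datum :: "('j, 'y::ab_group_add, 'x::ab_group_add) datum \<Rightarrow> bool" where
  "root_datum D \<longleftrightarrow>
     cartan_datum (idx D) (form D) \<and>
     fg_free_abelian TYPE('y) \<and> fg_free_abelian TYPE('x) \<and>
     perfect_pairing (pairing D) \<and>
     inj_on (coroot D) (idx D) \<and> inj_on (simple_root D) (idx D) \<and>
     (\<forall>i\<in>idx D. \<forall>j\<in>idx D.
        of_int (pairing D (coroot D i) (simple_root D j))
          = (2 * of_int (dot D i j) / of_int (dot D i i) :: rat))"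

definition contractible_edge :: "('j, 'y, 'x) datum \<Rightarrow> 'j \<Rightarrow> 'j \<Rightarrow> bool" where
  "contractible_edge D ip im \<longleftrightarrow>
     ip \<in> idx D \<and> im \<in> idx D \<and>
     dot D ip ip = dot D im im \<and> dot D im im = - 2 * dot D ip im"

text \<open>Below, the index set of the contracted datum is a subset \<open>J\<close> of \<open>\<int>[I]\<close>, so an element of
  \<open>\<int>[J]\<close> is a formal combination of elements of \<open>\<int>[I]\<close>.  Evaluating it is the inclusion
  \<open>\<int>[J] \<subseteq> \<int>[I]\<close>.\<close>

definition lat_incl :: "(('j \<Rightarrow>\<^sub>0 int) \<Rightarrow>\<^sub>0 int) \<Rightarrow> ('j \<Rightarrow>\<^sub>0 int)" where
  "lat_incl = frag_extend (\<lambda>x. x)"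

definition izero :: "'j \<Rightarrow> 'j \<Rightarrow> ('j \<Rightarrow>\<^sub>0 int)" where
  "izero ip im = frag_of ip + frag_of im"

definition contraction ::
  "('j, 'y::ab_group_add, 'x::ab_group_add) datum \<Rightarrow> 'j \<Rightarrow> 'j \<Rightarrow> ('j \<Rightarrow>\<^sub>0 int, 'y, 'x) datum" where
  "contraction D ip im =
     \<lparr> idx = frag_of ` (idx D - {ip, im}) \<union> {izero ip im},
       form = (\<lambda>x y. form D (lat_incl x) (lat_incl y)),
       pairing = pairing D,
       coroot = (\<lambda>a. if a = izero ip im then coroot D ip + coroot D im
                     else coroot D (inv_into UNIV frag_of a)),
       simple_root = (\<lambda>a. if a = izero ip im then simple_root D ip + simple_root D im
                          else simple_root D (inv_into UNIV frag_of a)) \<rparr>"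


section \<open>Monoid algebras, quotients, tensor products and gradings\<close>

definition monoid_algebra :: "('m, 'r) monoid_scheme \<Rightarrow> ('k::comm_ring_1, 'm \<Rightarrow>\<^sub>0 'k) module" where
  "monoid_algebra M =
     \<lparr> carrier = {p. Poly_Mapping.keys p \<subseteq> carrier M},
       monoid.mult = (\<lambda>p q. \<Sum>s\<in>Poly_Mapping.keys p. \<Sum>t\<in>Poly_Mapping.keys q.
          Poly_Mapping.single (s \<otimes>\<^bsub>M\<^esub> t) (Poly_Mapping.lookup p s * Poly_Mapping.lookup q t)),
       one = Poly_Mapping.single \<one>\<^bsub>M\<^esub> 1,
       zero = 0,
       add = (+),
       module.smult = (\<lambda>c. Poly_Mapping.map ((*) c)) \<rparr>"

definition free_monoid :: "'g set \<Rightarrow> 'g list monoid" where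
  "free_monoid G = \<lparr> carrier = lists G, monoid.mult = (@), one = [] \<rparr>"

definition quot_algebra :: "('k, 'a) module \<Rightarrow> 'a set \<Rightarrow> ('k, 'a set) module" where
  "quot_algebra A J =
     ring.extend (A Quot J) (module.fields (\<lambda>c X. \<Union>x\<in>X. J +>\<^bsub>A\<^esub> (c \<odot>\<^bsub>A\<^esub> x)))"

definition alg_hom :: "('k, 'a) module \<Rightarrow> ('k, 'b) module \<Rightarrow> ('a \<Rightarrow> 'b) set" where
  "alg_hom A B = {f \<in> ring_hom A B. \<forall>c. \<forall>x\<in>carrier A. f (c \<odot>\<^bsub>A\<^esub> x) = c \<odot>\<^bsub>B\<^esub> f x}"

text \<open>The tensor product of two algebras is the free vector space on pairs modulo the bilinearity
  relations.  The free vector space on pairs is also the algebra of the multiplicative monoid of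
  pairs; as multiplying a relation by a pair gives a relation again, the ideal generated by the
  relations is their linear span, and the quotient has the product
  \<open>(a \<otimes> b) (c \<otimes> d) = ac \<otimes> bd\<close>.\<close>

definition tensor_relations :: "('k::comm_ring_1, 'a) module \<Rightarrow> ('k, 'b) module \<Rightarrow> ('a \<times> 'b \<Rightarrow>\<^sub>0 'k) set" where
  "tensor_relations A B =
     {Poly_Mapping.single (a \<oplus>\<^bsub>A\<^esub> a', b) 1 - Poly_Mapping.single (a, b) 1 - Poly_Mapping.single (a', b) 1
        | a a' b. a \<in> carrier A \<and> a' \<in> carrier A \<and> b \<in> carrier B} \<union>
     {Poly_Mapping.single (a, b \<oplus>\<^bsub>B\<^esub> b') 1 - Poly_Mapping.single (a, b) 1 - Poly_Mapping.single (a, b') 1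
        | a b b'. a \<in> carrier A \<and> b \<in> carrier B \<and> b' \<in> carrier B} \<union>
     {Poly_Mapping.single (c \<odot>\<^bsub>A\<^esub> a, b) 1 - Poly_Mapping.single (a, b) c
        | c a b. a \<in> carrier A \<and> b \<in> carrier B} \<union>
     {Poly_Mapping.single (a, c \<odot>\<^bsub>B\<^esub> b) 1 - Poly_Mapping.single (a, b) c
        | c a b. a \<in> carrier A \<and> b \<in> carrier B}"

definition tensor_ideal :: "('k::comm_ring_1, 'a) module \<Rightarrow> ('k, 'b) module \<Rightarrow> ('a \<times> 'b \<Rightarrow>\<^sub>0 'k) set" where
  "tensor_ideal A B = genideal (monoid_algebra (A \<times>\<times> B) :: ('k, 'a \<times> 'b \<Rightarrow>\<^sub>0 'k) module) (tensor_relations A B)"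

definition tensor_algebra ::
  "('k::comm_ring_1, 'a) module \<Rightarrow> ('k, 'b) module \<Rightarrow> ('k, ('a \<times> 'b \<Rightarrow>\<^sub>0 'k) set) module" where
  "tensor_algebra A B = quot_algebra (monoid_algebra (A \<times>\<times> B)) (tensor_ideal A B)"

definition tensor_class ::
  "('k::comm_ring_1, 'a) module \<Rightarrow> ('k, 'b) module \<Rightarrow> ('a \<times> 'b \<Rightarrow>\<^sub>0 'k) \<Rightarrow> ('a \<times> 'b \<Rightarrow>\<^sub>0 'k) set" where
  "tensor_class A B p =
     tensor_ideal A B +>\<^bsub>(monoid_algebra (A \<times>\<times> B) :: ('k, 'a \<times> 'b \<Rightarrow>\<^sub>0 'k) module)\<^esub> p"

definition tensor ::
  "('k::comm_ring_1, 'a) module \<Rightarrow> ('k, 'b) module \<Rightarrow> 'a \<Rightarrow> 'b \<Rightarrow> ('a \<times> 'b \<Rightarrow>\<^sub>0 'k) set" where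
  "tensor A B a b = tensor_class A B (Poly_Mapping.single (a, b) 1)"

text \<open>For subspaces \<open>V\<close> of \<open>A\<close> and \<open>W\<close> of \<open>B\<close>, the tensor product \<open>V \<otimes> W\<close> is identified with
  its image in \<open>A \<otimes> B\<close> (the canonical map is injective over a field).\<close>

definition tensor_subspace ::
  "('k::field, 'a) module \<Rightarrow> ('k, 'b) module \<Rightarrow> 'a set \<Rightarrow> 'b set \<Rightarrow> ('a \<times> 'b \<Rightarrow>\<^sub>0 'k) set set" where
  "tensor_subspace A B V W = tensor_class A B ` {p. Poly_Mapping.keys p \<subseteq> V \<times> W}"

text \<open>For linear \<open>f\<close> on \<open>V\<close> and \<open>g\<close> on \<open>W\<close>, the map \<open>f \<otimes> g\<close> from \<open>V \<otimes> W\<close> to \<open>A' \<otimes> B'\<close>,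
  computed on an arbitrary expression of its argument as a combination of pure tensors from
  \<open>V \<times> W\<close>.\<close>

definition tensor_map ::
  "('k::field, 'a) module \<Rightarrow> ('k, 'b) module \<Rightarrow> ('k, 'c) module \<Rightarrow> ('k, 'd) module \<Rightarrow>
   'a set \<Rightarrow> 'b set \<Rightarrow> ('a \<Rightarrow> 'c) \<Rightarrow> ('b \<Rightarrow> 'd) \<Rightarrow>
   ('a \<times> 'b \<Rightarrow>\<^sub>0 'k) set \<Rightarrow> ('c \<times> 'd \<Rightarrow>\<^sub>0 'k) set" where
  "tensor_map A B A' B' V W f g =
     (\<lambda>z\<in>tensor_subspace A B V W.
        THE z'. \<exists>p. Poly_Mapping.keys p \<subseteq> V \<times> W \<and> z = tensor_class A B p \<and>
          z' = tensor_class A' B'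
                 (\<Sum>(a, b)\<in>Poly_Mapping.keys p.
                    Poly_Mapping.single (f a, g b) (Poly_Mapping.lookup p (a, b))))"

text \<open>The component in \<open>M g\<close> of an element of the direct sum of the subgroups \<open>M h\<close> of \<open>A\<close>.\<close>

definition direct_sum_proj :: "('a, 'r) ring_scheme \<Rightarrow> ('g \<Rightarrow> 'a set) \<Rightarrow> 'g \<Rightarrow> 'a \<Rightarrow> 'a" where
  "direct_sum_proj A M g x =
     (THE y. \<exists>f. (\<forall>h. f h \<in> M h) \<and> finite {h. f h \<noteq> \<zero>\<^bsub>A\<^esub>} \<and>
        x = (\<Oplus>\<^bsub>A\<^esub>h\<in>{h. f h \<noteq> \<zero>\<^bsub>A\<^esub>}. f h) \<and> y = f g)"


section \<open>The quantum group of a root datum\<close>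

type_synonym qv = "rat poly fract"

definition vv :: qv where
  "vv = Fract [:0, 1:] 1"

definition vsub :: "('j, 'y, 'x) datum \<Rightarrow> 'j \<Rightarrow> qv" where
  "vsub D i = vv powi (dot D i i div 2)"

definition qint :: "qv \<Rightarrow> nat \<Rightarrow> qv" where
  "qint q n = (q ^ n - inverse q ^ n) / (q - inverse q)"

definition qfact :: "qv \<Rightarrow> nat \<Rightarrow> qv" where
  "qfact q n = (\<Prod>k=1..n. qint q k)"

datatype ('j, 'y) gen = GE 'j | GF 'j | GK 'y

definition gens :: "('j, 'y, 'x) datum \<Rightarrow> ('j, 'y) gen set" where
  "gens D = GE ` idx D \<union> GF ` idx D \<union> range GK"

definition free_alg :: "('j, 'y, 'x) datum \<Rightarrow> (qv, ('j, 'y) gen list \<Rightarrow>\<^sub>0 qv) module" where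
  "free_alg D = monoid_algebra (free_monoid (gens D))"

abbreviation word :: "'g list \<Rightarrow> 'g list \<Rightarrow>\<^sub>0 qv" where
  "word w \<equiv> Poly_Mapping.single w 1"

text \<open>The element \<open>((i \<cdot> i) / 2) i\<close> of \<open>Y\<close>, written as an iterated sum.\<close>

definition scaled_coroot :: "('j, 'y::ab_group_add, 'x) datum \<Rightarrow> 'j \<Rightarrow> 'y" where
  "scaled_coroot D i = (\<Sum>k<nat (dot D i i div 2). coroot D i)"

definition serre :: "('j, 'y, 'x) datum \<Rightarrow> ('j \<Rightarrow> ('j, 'y) gen) \<Rightarrow> 'j \<Rightarrow> 'j \<Rightarrow> ('j, 'y) gen list \<Rightarrow>\<^sub>0 qv" where
  "serre D x i j =
     (let N = nat (1 - pairing D (coroot D i) (simple_root D j)) in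
      \<Sum>r\<le>N. Poly_Mapping.single (replicate (N - r) (x i) @ [x j] @ replicate r (x i))
                ((- 1) ^ r / (qfact (vsub D i) (N - r) * qfact (vsub D i) r)))"

definition relations :: "('j, 'y::ab_group_add, 'x) datum \<Rightarrow> (('j, 'y) gen list \<Rightarrow>\<^sub>0 qv) set" where
  "relations D =
     {word [GK 0] - word []} \<union>
     {word [GK \<mu>, GK \<mu>'] - word [GK (\<mu> + \<mu>')] | \<mu> \<mu>'. True} \<union>
     {word [GK \<mu>, GE i] - Poly_Mapping.single [GE i, GK \<mu>] (vv powi pairing D \<mu> (simple_root D i))
        | \<mu> i. i \<in> idx D} \<union>
     {word [GK \<mu>, GF i] - Poly_Mapping.single [GF i, GK \<mu>] (vv powi (- pairing D \<mu> (simple_root D i)))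
        | \<mu> i. i \<in> idx D} \<union>
     {word [GE i, GF j] - word [GF j, GE i] -
        (if i = j
         then Poly_Mapping.single [GK (scaled_coroot D i)] (1 / (vsub D i - inverse (vsub D i)))
            - Poly_Mapping.single [GK (- scaled_coroot D i)] (1 / (vsub D i - inverse (vsub D i)))
         else 0)
        | i j. i \<in> idx D \<and> j \<in> idx D} \<union>
     {serre D x i j | x i j. x \<in> {GE, GF} \<and> i \<in> idx D \<and> j \<in> idx D \<and> i \<noteq> j}"

definition rel_ideal :: "('j, 'y::ab_group_add, 'x) datum \<Rightarrow> (('j, 'y) gen list \<Rightarrow>\<^sub>0 qv) set" where
  "rel_ideal D = genideal (free_alg D) (relations D)"

type_synonym ('j, 'y) qgrp = "(('j, 'y) gen list \<Rightarrow>\<^sub>0 qv) set"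

definition QG :: "('j, 'y::ab_group_add, 'x) datum \<Rightarrow> (qv, ('j, 'y) qgrp) module" where
  "QG D = quot_algebra (free_alg D) (rel_ideal D)"

definition QG_class :: "('j, 'y::ab_group_add, 'x) datum \<Rightarrow> (('j, 'y) gen list \<Rightarrow>\<^sub>0 qv) \<Rightarrow> ('j, 'y) qgrp" where
  "QG_class D p = rel_ideal D +>\<^bsub>free_alg D\<^esub> p"

definition Egen :: "('j, 'y::ab_group_add, 'x) datum \<Rightarrow> 'j \<Rightarrow> ('j, 'y) qgrp" where
  "Egen D i = QG_class D (word [GE i])"

definition Fgen :: "('j, 'y::ab_group_add, 'x) datum \<Rightarrow> 'j \<Rightarrow> ('j, 'y) qgrp" where
  "Fgen D i = QG_class D (word [GF i])"

definition Kgen :: "('j, 'y::ab_group_add, 'x) datum \<Rightarrow> 'y \<Rightarrow> ('j, 'y) qgrp" where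
  "Kgen D \<mu> = QG_class D (word [GK \<mu>])"

fun gen_degree :: "('j, 'y) gen \<Rightarrow> ('j \<Rightarrow>\<^sub>0 int)" where
  "gen_degree (GE i) = frag_of i"
| "gen_degree (GF i) = - frag_of i"
| "gen_degree (GK \<mu>) = 0"

definition QG_deg :: "('j, 'y::ab_group_add, 'x) datum \<Rightarrow> ('j \<Rightarrow>\<^sub>0 int) \<Rightarrow> ('j, 'y) qgrp set" where
  "QG_deg D \<nu> = QG_class D ` {p \<in> carrier (free_alg D).
     \<forall>w\<in>Poly_Mapping.keys p. sum_list (map gen_degree w) = \<nu>}"

text \<open>The comultiplication is given by its values on generators, which determine a homomorphism
  on the carrier; the predicate does not constrain the values outside the carrier.\<close>

definition is_comult ::
  "('j, 'y::ab_group_add, 'x) datum \<Rightarrow>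
   (('j, 'y) qgrp \<Rightarrow> (('j, 'y) qgrp \<times> ('j, 'y) qgrp \<Rightarrow>\<^sub>0 qv) set) \<Rightarrow> bool" where
  "is_comult D \<Delta> \<longleftrightarrow>
     (let A = QG D; T = tensor_algebra A A; t = tensor A A in
      \<Delta> \<in> alg_hom A T \<and>
      (\<forall>i\<in>idx D. \<Delta> (Egen D i) = t (Egen D i) \<one>\<^bsub>A\<^esub> \<oplus>\<^bsub>T\<^esub> t (Kgen D (scaled_coroot D i)) (Egen D i)) \<and>
      (\<forall>i\<in>idx D. \<Delta> (Fgen D i) = t (Fgen D i) (Kgen D (- scaled_coroot D i)) \<oplus>\<^bsub>T\<^esub> t \<one>\<^bsub>A\<^esub> (Fgen D i)) \<and>
      (\<forall>\<mu>. \<Delta> (Kgen D \<mu>) = t (Kgen D \<mu>) (Kgen D \<mu>)))"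

definition comult_comp ::
  "('j, 'y::ab_group_add, 'x) datum \<Rightarrow>
   (('j, 'y) qgrp \<Rightarrow> (('j, 'y) qgrp \<times> ('j, 'y) qgrp \<Rightarrow>\<^sub>0 qv) set) \<Rightarrow>
   ('j \<Rightarrow>\<^sub>0 int) \<Rightarrow> ('j \<Rightarrow>\<^sub>0 int) \<Rightarrow> ('j \<Rightarrow>\<^sub>0 int) \<Rightarrow>
   ('j, 'y) qgrp \<Rightarrow> (('j, 'y) qgrp \<times> ('j, 'y) qgrp \<Rightarrow>\<^sub>0 qv) set" where
  "comult_comp D \<Delta> \<nu> \<tau> \<omega> =
     (\<lambda>x\<in>QG_deg D \<nu>.
        direct_sum_proj (tensor_algebra (QG D) (QG D))
          (\<lambda>(\<alpha>, \<beta>). tensor_subspace (QG D) (QG D) (QG_deg D \<alpha>) (QG_deg D \<beta>))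
          (\<tau>, \<omega>) (\<Delta> x))"

text \<open>As for the comultiplication, the homomorphism is determined on the carrier by its values on
  generators.  Its injectivity is not required here.\<close>

definition is_contraction_hom ::
  "('j, 'y::ab_group_add, 'x::ab_group_add) datum \<Rightarrow> 'j \<Rightarrow> 'j \<Rightarrow> int \<Rightarrow>
   (('j \<Rightarrow>\<^sub>0 int, 'y) qgrp \<Rightarrow> ('j, 'y) qgrp) \<Rightarrow> bool" where
  "is_contraction_hom D ip im \<epsilon> \<Psi> \<longleftrightarrow>
     (let C = contraction D ip im; i0 = izero ip im; A = QG D in
      \<Psi> \<in> alg_hom (QG C) A \<and>
      (\<forall>i\<in>idx D - {ip, im}. \<Psi> (Egen C (frag_of i)) = Egen D i \<and> \<Psi> (Fgen C (frag_of i)) = Fgen D i) \<and>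
      (\<forall>\<mu>. \<Psi> (Kgen C \<mu>) = Kgen D \<mu>) \<and>
      \<Psi> (Egen C i0) = Egen D ip \<otimes>\<^bsub>A\<^esub> Egen D im
                    \<ominus>\<^bsub>A\<^esub> (vsub C i0 powi (- \<epsilon>)) \<odot>\<^bsub>A\<^esub> (Egen D im \<otimes>\<^bsub>A\<^esub> Egen D ip) \<and>
      \<Psi> (Fgen C i0) = Fgen D im \<otimes>\<^bsub>A\<^esub> Fgen D ip
                    \<ominus>\<^bsub>A\<^esub> (vsub C i0 powi \<epsilon>) \<odot>\<^bsub>A\<^esub> (Fgen D ip \<otimes>\<^bsub>A\<^esub> Fgen D im))"

end

theory Submission
  imports Defs
begin

text \<open>
The map \<open>\<Psi>\<close> is not a homomorphism of coalgebras.  Expanding the coproduct of the image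
\<open>E\<^sub>+ E\<^sub>- - q E\<^sub>- E\<^sub>+\<close> of the new generator yields the expected terms together with cross terms that have
\<open>E\<^sub>+\<close> in one tensor factor and \<open>E\<^sub>-\<close> in the other.  Commuting the \<open>K\<close> to the right merges these into one
multiple of \<open>E\<^sub>+ K\<^sub>- \<otimes> E\<^sub>-\<close> and one of \<open>E\<^sub>- K\<^sub>+ \<otimes> E\<^sub>+\<close>.  The choice of \<open>q\<close> makes one coefficient vanish, and what
remains is a multiple of \<open>E\<^sub>+ K\<^sub>- \<otimes> E\<^sub>-\<close> for \<open>\<epsilon> = 1\<close> and of \<open>E\<^sub>- K\<^sub>+ \<otimes> E\<^sub>+\<close> for \<open>\<epsilon> = -1\<close>
(lemmas \<open>tensor_commutator_left\<close> and \<open>tensor_commutator_right\<close>, the latter for \<open>F\<close>).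

Call imbalance of a degree in \<open>\<int>[I]\<close> its coefficient at \<open>ip\<close> minus its coefficient at \<open>im\<close>.  It vanishes on the
lattice of the contracted datum, whereas the first factor of every surviving cross term, for \<open>E\<close> and for \<open>F\<close>
alike, has imbalance \<open>\<epsilon>\<close>.  Filter the tensor product by \<open>\<epsilon>\<close> times the imbalance of the first factor.  This
filtration is multiplicative (\<open>filt_mult\<close>) and \<open>(\<Psi> \<otimes> \<Psi>) \<circ> \<Delta>C\<close> takes values in level zero
(\<open>lift_filt\<close>), so the property that \<open>\<Delta>I \<circ> \<Psi>\<close> and \<open>(\<Psi> \<otimes> \<Psi>) \<circ> \<Delta>C\<close> differ by terms of level one
is inherited by products and sums; it holds on generators, hence everywhere (\<open>agrees_mod_filt_all\<close>).
The projection to degrees of the contracted datum kills level one (\<open>tproj_filt\<close>), which gives the theorem.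

To make this precise, components have to be computed by maps.  The relations of the quantum group are
homogeneous, so its degree projections exist as linear maps (\<open>free_proj_ideal\<close>); linear maps have tensor
products (\<open>push_ideal\<close>); and the unique component of an element in a direct sum is its image under the
projection (\<open>direct_sum_proj_eq\<close>).
\<close>

section \<open>Linear extension\<close>

text \<open>The coefficient is an argument of \<open>\<phi>\<close> rather than a factor, so that one construction covers products of
monomials, relabelling of basis elements and projection to a part of the basis.\<close>

definition linext :: "('m \<Rightarrow> 'k::zero \<Rightarrow> 'b::comm_monoid_add) \<Rightarrow> ('m \<Rightarrow>\<^sub>0 'k) \<Rightarrow> 'b"
  where "linext \<phi> p = (\<Sum>s\<in>Poly_Mapping.keys p. \<phi> s (Poly_Mapping.lookup p s))"

lemma linext_zero [simp]: "linext \<phi> 0 = 0"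
  by (simp add: linext_def)

lemma linext_single: "\<phi> s 0 = 0 \<Longrightarrow> linext \<phi> (Poly_Mapping.single s c) = \<phi> s c"
  by (simp add: linext_def)

lemma linext_add_fun: "linext (\<lambda>s c. \<phi> s c + \<psi> s c) p = linext \<phi> p + linext \<psi> p"
  by (simp add: linext_def sum.distrib)

lemma linext_add:
  fixes \<phi> :: "'m \<Rightarrow> 'k::monoid_add \<Rightarrow> 'b::ab_group_add"
  assumes "\<And>s c d. \<phi> s (c + d) = \<phi> s c + \<phi> s d"
  shows "linext \<phi> (p + q) = linext \<phi> p + linext \<phi> q"
proof -
  have z: "\<phi> s 0 = 0" for s
    using assms[of s 0 0] by simp
  let ?K = "Poly_Mapping.keys p \<union> Poly_Mapping.keys q"
  have *: "linext \<phi> r = (\<Sum>s\<in>?K. \<phi> s (Poly_Mapping.lookup r s))"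
    if "Poly_Mapping.keys r \<subseteq> ?K" for r
    unfolding linext_def using that
    by (intro sum.mono_neutral_left) (auto simp: z in_keys_iff)
  show ?thesis
    using Poly_Mapping.keys_add[of p q]
    by (simp add: * lookup_add assms sum.distrib)
qed

lemma keys_linext_subset:
  assumes "Poly_Mapping.keys p \<subseteq> S" "\<And>s c. s \<in> S \<Longrightarrow> Poly_Mapping.keys (\<phi> s c) \<subseteq> T"
  shows "Poly_Mapping.keys (linext \<phi> p) \<subseteq> T"
  using assms Poly_Mapping.keys_sum[of "\<lambda>s. \<phi> s (Poly_Mapping.lookup p s)" "Poly_Mapping.keys p"]
  unfolding linext_def by blast

text \<open>The working tool for everything that follows: an identity between additive maps holds as soon as it holds
on monomials.\<close>

lemma poly_mapping_add_induct [consumes 1, case_names zero single add]: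
  fixes p :: "'m \<Rightarrow>\<^sub>0 'k::comm_monoid_add"
  assumes "Poly_Mapping.keys p \<subseteq> S"
    and "P 0"
    and "\<And>s c. s \<in> S \<Longrightarrow> P (Poly_Mapping.single s c)"
    and "\<And>p q. Poly_Mapping.keys p \<subseteq> S \<Longrightarrow> Poly_Mapping.keys q \<subseteq> S \<Longrightarrow> P p \<Longrightarrow> P q \<Longrightarrow> P (p + q)"
  shows "P p"
proof -
  have "P (\<Sum>k\<in>K. Poly_Mapping.single k (Poly_Mapping.lookup p k)) \<and>
     Poly_Mapping.keys (\<Sum>k\<in>K. Poly_Mapping.single k (Poly_Mapping.lookup p k)) \<subseteq> S"
    if "finite K" "K \<subseteq> S" for K
    using that
  proof (induction K rule: finite_induct)
    case empty
    then show ?case using assms(2) by simp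
  next
    case (insert k K)
    have "Poly_Mapping.keys (Poly_Mapping.single k (Poly_Mapping.lookup p k) +
        (\<Sum>k\<in>K. Poly_Mapping.single k (Poly_Mapping.lookup p k))) \<subseteq> S"
      by (rule order_trans[OF Poly_Mapping.keys_add])
        (use insert in auto)
    moreover have "P (Poly_Mapping.single k (Poly_Mapping.lookup p k) +
        (\<Sum>k\<in>K. Poly_Mapping.single k (Poly_Mapping.lookup p k)))"
      using insert by (intro assms(4) assms(3)) auto
    ultimately show ?case using insert by simp
  qed
  moreover have "(\<Sum>k\<in>Poly_Mapping.keys p. Poly_Mapping.single k (Poly_Mapping.lookup p k)) = p"
    by (rule poly_mapping_eqI) (simp add: lookup_sum lookup_single when_def in_keys_iff)
  ultimately show ?thesis
    using assms(1) by (metis finite_keys)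
qed

lemma keys_add_subset:
  "Poly_Mapping.keys p \<subseteq> S \<Longrightarrow> Poly_Mapping.keys q \<subseteq> S \<Longrightarrow> Poly_Mapping.keys (p + q) \<subseteq> S"
  using Poly_Mapping.keys_add[of p q] by auto

lemma keys_diff_subset:
  "Poly_Mapping.keys p \<subseteq> S \<Longrightarrow> Poly_Mapping.keys q \<subseteq> S \<Longrightarrow> Poly_Mapping.keys (p - q :: _ \<Rightarrow>\<^sub>0 _::ab_group_add) \<subseteq> S"
  using Poly_Mapping.keys_diff[of p q] by auto

lemma map_scale_single [simp]:
  "Poly_Mapping.map ((*) c) (Poly_Mapping.single s d) = Poly_Mapping.single s (c * d :: 'k::comm_ring_1)"
  by (rule poly_mapping_eqI) (simp add: Poly_Mapping.map.rep_eq lookup_single when_def)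

lemma lookup_map_scale [simp]:
  "Poly_Mapping.lookup (Poly_Mapping.map ((*) c) p) s = (c::'k::comm_ring_1) * Poly_Mapping.lookup p s"
  by (simp add: Poly_Mapping.map.rep_eq when_def)

lemma map_scale_add [simp]:
  "Poly_Mapping.map ((*) (c::'k::comm_ring_1)) (p + q) = Poly_Mapping.map ((*) c) p + Poly_Mapping.map ((*) c) q"
  by (rule poly_mapping_eqI) (simp add: lookup_add algebra_simps)

lemma keys_map_scale: "Poly_Mapping.keys (Poly_Mapping.map ((*) (c::'k::comm_ring_1)) p) \<subseteq> Poly_Mapping.keys p"
  by (auto simp: in_keys_iff)

section \<open>Associative algebras and their quotients\<close>

text \<open>Multiplication need not commute, and the scalars form a type with ring operations, as in the
definition of the quantum group.\<close>

locale assoc_algebra = ring A for A :: "('k::comm_ring_1, 'a) module" (structure) +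
  assumes smult_closed [intro, simp]: "x \<in> carrier A \<Longrightarrow> c \<odot> x \<in> carrier A"
    and smult_r_distr: "x \<in> carrier A \<Longrightarrow> y \<in> carrier A \<Longrightarrow> c \<odot> (x \<oplus> y) = c \<odot> x \<oplus> c \<odot> y"
    and smult_l_distr: "x \<in> carrier A \<Longrightarrow> (c + d) \<odot> x = c \<odot> x \<oplus> d \<odot> x"
    and smult_smult: "x \<in> carrier A \<Longrightarrow> (c * d) \<odot> x = c \<odot> (d \<odot> x)"
    and smult_one [simp]: "x \<in> carrier A \<Longrightarrow> 1 \<odot> x = x"
    and smult_mult_l: "x \<in> carrier A \<Longrightarrow> y \<in> carrier A \<Longrightarrow> (c \<odot> x) \<otimes> y = c \<odot> (x \<otimes> y)"
    and smult_mult_r: "x \<in> carrier A \<Longrightarrow> y \<in> carrier A \<Longrightarrow> x \<otimes> (c \<odot> y) = c \<odot> (x \<otimes> y)"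
begin

lemma smult_zero_l [simp]: "x \<in> carrier A \<Longrightarrow> 0 \<odot> x = \<zero>"
  using smult_l_distr[of x 0 0] by (simp add: add.l_cancel_one')

lemma smult_zero_r [simp]: "c \<odot> \<zero> = \<zero>"
  using smult_r_distr[of \<zero> \<zero> c] by (simp add: add.l_cancel_one')

lemma minus_eq_zero_iff: "x \<in> carrier A \<Longrightarrow> y \<in> carrier A \<Longrightarrow> x \<ominus> y = \<zero> \<longleftrightarrow> x = y"
  by (metis a_minus_def add.inv_closed minus_equality minus_minus r_neg)

lemma minus_minus_eq_zeroD:
  assumes "x \<ominus> y \<ominus> z = \<zero>" "x \<in> carrier A" "y \<in> carrier A" "z \<in> carrier A"
  shows "x = y \<oplus> z"
proof -
  have "x \<ominus> y = z" using assms by (simp add: minus_eq_zero_iff)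
  moreover have "(x \<ominus> y) \<oplus> y = x" using assms by (simp add: a_minus_def a_assoc l_neg)
  ultimately show ?thesis using assms by (simp add: a_comm)
qed

lemma add_minus_minus_zero: "x \<in> carrier A \<Longrightarrow> y \<in> carrier A \<Longrightarrow> x \<oplus> y \<ominus> x \<ominus> y = \<zero>"
  by (simp add: minus_eq_zero_iff) (simp add: a_minus_def a_comm[of x y] a_assoc r_neg)

lemma smult_diff: "x \<in> carrier A \<Longrightarrow> (c - d) \<odot> x = c \<odot> x \<oplus> (- d) \<odot> x"
  using smult_l_distr[of x c "- d"] by simp

lemma smult_minus_one: "x \<in> carrier A \<Longrightarrow> (-1) \<odot> x = \<ominus> x"
  using smult_l_distr[of x "-1" 1] by (simp add: minus_equality)

end

lemma monoid_algebra_mult_linext: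
  "p \<otimes>\<^bsub>monoid_algebra M\<^esub> q =
     linext (\<lambda>s c. linext (\<lambda>t d. Poly_Mapping.single (s \<otimes>\<^bsub>M\<^esub> t) (c * d)) q) p"
  by (simp add: monoid_algebra_def linext_def)

lemma monoid_algebra_simps [simp]:
  "carrier (monoid_algebra M) = {p. Poly_Mapping.keys p \<subseteq> carrier M}"
  "\<zero>\<^bsub>monoid_algebra M\<^esub> = 0"
  "\<one>\<^bsub>monoid_algebra M\<^esub> = Poly_Mapping.single \<one>\<^bsub>M\<^esub> 1"
  "p \<oplus>\<^bsub>monoid_algebra M\<^esub> q = p + q"
  "c \<odot>\<^bsub>monoid_algebra M\<^esub> p = Poly_Mapping.map ((*) c) p"
  by (auto simp: monoid_algebra_def)

lemma monoid_algebra_mult_single [simp]: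
  "Poly_Mapping.single s c \<otimes>\<^bsub>monoid_algebra M\<^esub> Poly_Mapping.single t d = Poly_Mapping.single (s \<otimes>\<^bsub>M\<^esub> t) (c * d)"
  by (simp add: monoid_algebra_mult_linext linext_single)

lemma monoid_algebra_mult_add_left:
  "(p + p') \<otimes>\<^bsub>monoid_algebra M\<^esub> q = p \<otimes>\<^bsub>monoid_algebra M\<^esub> q + p' \<otimes>\<^bsub>monoid_algebra M\<^esub> q"
  unfolding monoid_algebra_mult_linext
  by (rule linext_add) (simp add: distrib_right single_add linext_add_fun)

lemma monoid_algebra_mult_add_right:
  "p \<otimes>\<^bsub>monoid_algebra M\<^esub> (q + q') = p \<otimes>\<^bsub>monoid_algebra M\<^esub> q + p \<otimes>\<^bsub>monoid_algebra M\<^esub> q'"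
  unfolding monoid_algebra_mult_linext
  by (subst linext_add) (auto simp: distrib_left single_add linext_add_fun)

lemma monoid_algebra_mult_zero [simp]:
  "0 \<otimes>\<^bsub>monoid_algebra M\<^esub> q = 0" "p \<otimes>\<^bsub>monoid_algebra M\<^esub> 0 = 0"
  by (auto simp: monoid_algebra_mult_linext linext_def)

text \<open>A product of monomials is a monomial, so by additivity in each variable every axiom comes down to the
corresponding law of the monoid or of the coefficients.\<close>

lemma assoc_algebra_monoid_algebra:
  assumes "Group.monoid M"
  shows "assoc_algebra (monoid_algebra M :: ('k::comm_ring_1, 'm \<Rightarrow>\<^sub>0 'k) module)"
proof -
  interpret M: Group.monoid M by fact
  let ?R = "monoid_algebra M :: ('k, 'm \<Rightarrow>\<^sub>0 'k) module"
  note d = monoid_algebra_mult_add_left monoid_algebra_mult_add_right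
  have closed: "Poly_Mapping.keys (p \<otimes>\<^bsub>?R\<^esub> q) \<subseteq> carrier M"
    if "Poly_Mapping.keys p \<subseteq> carrier M" "Poly_Mapping.keys q \<subseteq> carrier M" for p q
    unfolding monoid_algebra_mult_linext
    by (intro keys_linext_subset[OF that(1)] keys_linext_subset[OF that(2)]) auto
  have assoc: "(p \<otimes>\<^bsub>?R\<^esub> q) \<otimes>\<^bsub>?R\<^esub> r = p \<otimes>\<^bsub>?R\<^esub> (q \<otimes>\<^bsub>?R\<^esub> r)"
    if p: "Poly_Mapping.keys p \<subseteq> carrier M" and q: "Poly_Mapping.keys q \<subseteq> carrier M"
      and r: "Poly_Mapping.keys r \<subseteq> carrier M" for p q r
    using p
  proof (induction p rule: poly_mapping_add_induct)
    case (single s c)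
    show ?case using q
    proof (induction q rule: poly_mapping_add_induct)
      case (single t d)
      show ?case using r
        by (induction r rule: poly_mapping_add_induct)
          (use single \<open>s \<in> carrier M\<close> in \<open>simp_all add: d M.m_assoc mult.assoc\<close>)
    qed (simp_all add: d)
  qed (simp_all add: d)
  have unit: "\<one>\<^bsub>?R\<^esub> \<otimes>\<^bsub>?R\<^esub> p = p \<and> p \<otimes>\<^bsub>?R\<^esub> \<one>\<^bsub>?R\<^esub> = p"
    if "Poly_Mapping.keys p \<subseteq> carrier M" for p
    using that by (induction p rule: poly_mapping_add_induct) (simp_all add: d)
  have map_zero: "Poly_Mapping.map ((*) c) 0 = (0 :: 'm \<Rightarrow>\<^sub>0 'k)" for c
    by (rule poly_mapping_eqI) simp
  have sl: "Poly_Mapping.map ((*) c) p \<otimes>\<^bsub>?R\<^esub> q = Poly_Mapping.map ((*) c) (p \<otimes>\<^bsub>?R\<^esub> q)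
     \<and> q \<otimes>\<^bsub>?R\<^esub> Poly_Mapping.map ((*) c) p = Poly_Mapping.map ((*) c) (q \<otimes>\<^bsub>?R\<^esub> p)"
    if p: "Poly_Mapping.keys p \<subseteq> carrier M" and q: "Poly_Mapping.keys q \<subseteq> carrier M" for p q and c :: 'k
    using p
  proof (induction p rule: poly_mapping_add_induct)
    case (single s e)
    show ?case using q
      by (induction q rule: poly_mapping_add_induct) (simp_all add: d map_zero mult.assoc mult.left_commute)
  qed (simp_all add: d map_zero)
  have ag: "abelian_group ?R"
  proof (rule abelian_groupI)
    fix x assume "x \<in> carrier ?R"
    then show "\<exists>y\<in>carrier ?R. y \<oplus>\<^bsub>?R\<^esub> x = \<zero>\<^bsub>?R\<^esub>"
      by (intro bexI[of _ "-x"]) auto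
  qed (simp_all add: keys_add_subset ac_simps)
  have "ring ?R"
  proof (rule ringI[OF ag])
    show "Group.monoid ?R"
      by (rule monoidI) (use closed assoc unit in simp_all)
  qed (simp_all add: d)
  then show ?thesis
    unfolding assoc_algebra_def assoc_algebra_axioms_def
  proof (intro conjI allI impI)
    fix c :: 'k and x assume "x \<in> carrier ?R"
    then show "c \<odot>\<^bsub>?R\<^esub> x \<in> carrier ?R" using keys_map_scale by fastforce
  next
    fix c d :: 'k and x assume "x \<in> carrier ?R"
    show "(c + d) \<odot>\<^bsub>?R\<^esub> x = c \<odot>\<^bsub>?R\<^esub> x \<oplus>\<^bsub>?R\<^esub> d \<odot>\<^bsub>?R\<^esub> x"
      by (rule poly_mapping_eqI) (simp add: lookup_add algebra_simps)
    show "(c * d) \<odot>\<^bsub>?R\<^esub> x = c \<odot>\<^bsub>?R\<^esub> (d \<odot>\<^bsub>?R\<^esub> x)"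
      by (rule poly_mapping_eqI) (simp add: algebra_simps)
    show "1 \<odot>\<^bsub>?R\<^esub> x = x"
      by (rule poly_mapping_eqI) simp
  qed (simp_all add: sl)
qed

text \<open>The ideal generated by \<open>S\<close> is the additive span of the products \<open>m s n\<close> with \<open>s\<close> in \<open>S\<close> and monomials
\<open>m\<close> and \<open>n\<close>.  Hence a condition on the elements of the ideal that is merely additive needs checking only
on such products.  This is how linear maps that are not multiplicative, such as projections to a graded
component, are shown to descend to a quotient.\<close>

lemma genideal_monoid_algebra_subset:
  fixes S :: "('m \<Rightarrow>\<^sub>0 'k::comm_ring_1) set"
  assumes M: "Group.monoid M"
    and S: "S \<subseteq> carrier (monoid_algebra M)"
    and zero: "0 \<in> K"
    and add: "\<And>p q. p \<in> K \<Longrightarrow> q \<in> K \<Longrightarrow> p + q \<in> K"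
    and gen: "\<And>m n c s. m \<in> carrier M \<Longrightarrow> n \<in> carrier M \<Longrightarrow> s \<in> S \<Longrightarrow>
       Poly_Mapping.single m c \<otimes>\<^bsub>monoid_algebra M\<^esub> s \<otimes>\<^bsub>monoid_algebra M\<^esub> Poly_Mapping.single n 1 \<in> K"
  shows "genideal (monoid_algebra M :: ('k, 'm \<Rightarrow>\<^sub>0 'k) module) S \<subseteq> K"
proof -
  let ?R = "monoid_algebra M :: ('k, 'm \<Rightarrow>\<^sub>0 'k) module"
  interpret M: Group.monoid M by fact
  interpret R: assoc_algebra ?R by (rule assoc_algebra_monoid_algebra[OF M])
  note d = monoid_algebra_mult_add_left monoid_algebra_mult_add_right
  \<comment> \<open>\<open>K\<close> itself need not be an ideal; the elements all of whose multiples by monomials stay in \<open>K\<close> form one.\<close>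
  define L where "L = {p \<in> carrier ?R. \<forall>m n c. m \<in> carrier M \<longrightarrow> n \<in> carrier M \<longrightarrow>
     Poly_Mapping.single m c \<otimes>\<^bsub>?R\<^esub> p \<otimes>\<^bsub>?R\<^esub> Poly_Mapping.single n 1 \<in> K}"
  have zL: "0 \<in> L" using zero by (simp add: L_def)
  have aL: "p + q \<in> L" if "p \<in> L" "q \<in> L" for p q
    using that by (simp add: L_def d add keys_add_subset)
  have sc: "Poly_Mapping.single m c \<in> carrier ?R" if "m \<in> carrier M" for m c
    using that by auto
  have lL: "q \<otimes>\<^bsub>?R\<^esub> p \<in> L" if p: "p \<in> L" and q: "q \<in> carrier ?R" for p q
  proof -
    have "Poly_Mapping.keys q \<subseteq> carrier M" using q by simp
    then show ?thesis
    proof (induction q rule: poly_mapping_add_induct)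
      case (single s c)
      then show ?case
        using p by (auto simp del: monoid_algebra_simps(1) simp: L_def sc R.m_assoc[symmetric])
    qed (simp_all add: d zL aL)
  qed
  have rL: "p \<otimes>\<^bsub>?R\<^esub> q \<in> L" if p: "p \<in> L" and q: "q \<in> carrier ?R" for p q
  proof -
    have "Poly_Mapping.keys q \<subseteq> carrier M" using q by simp
    then show ?thesis
    proof (induction q rule: poly_mapping_add_induct)
      case (single t e)
      have "Poly_Mapping.single m c \<otimes>\<^bsub>?R\<^esub> (p \<otimes>\<^bsub>?R\<^esub> Poly_Mapping.single t e) \<otimes>\<^bsub>?R\<^esub> Poly_Mapping.single n 1 \<in> K"
        if "m \<in> carrier M" "n \<in> carrier M" for m n c
      proof -
        have pc: "p \<in> carrier ?R" using p by (simp add: L_def)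
        have e: "Poly_Mapping.single t e = e \<odot>\<^bsub>?R\<^esub> Poly_Mapping.single t 1" by simp
        have "Poly_Mapping.single m c \<otimes>\<^bsub>?R\<^esub> (p \<otimes>\<^bsub>?R\<^esub> Poly_Mapping.single t e) \<otimes>\<^bsub>?R\<^esub> Poly_Mapping.single n 1
          = (e \<odot>\<^bsub>?R\<^esub> Poly_Mapping.single m c) \<otimes>\<^bsub>?R\<^esub> p \<otimes>\<^bsub>?R\<^esub> (Poly_Mapping.single t 1 \<otimes>\<^bsub>?R\<^esub> Poly_Mapping.single n 1)"
          unfolding e using pc sc[OF that(1)] sc[OF that(2)] sc[OF single]
          by (simp del: monoid_algebra_simps monoid_algebra_mult_single
              add: R.m_assoc R.smult_mult_l R.smult_mult_r)
        also have "\<dots> \<in> K"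
          using p that single by (simp add: L_def)
        finally show ?thesis .
      qed
      then show ?case
        using p single sc[OF single] unfolding L_def
        by (simp del: monoid_algebra_simps(1))
    qed (simp_all add: d zL aL)
  qed
  have inv: "\<ominus>\<^bsub>?R\<^esub> p \<in> L" if "p \<in> L" for p
  proof -
    have pc: "p \<in> carrier ?R" using that by (simp add: L_def)
    then have "\<ominus>\<^bsub>?R\<^esub> p = (\<ominus>\<^bsub>?R\<^esub> \<one>\<^bsub>?R\<^esub>) \<otimes>\<^bsub>?R\<^esub> p"
      by (simp del: monoid_algebra_simps add: R.l_minus)
    then show ?thesis using lL[OF that, of "\<ominus>\<^bsub>?R\<^esub> \<one>\<^bsub>?R\<^esub>"]
      by (simp del: monoid_algebra_simps)
  qed
  have "ideal L ?R"
  proof (rule idealI[OF R.ring_axioms])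
    show "subgroup L (add_monoid ?R)"
    proof (rule R.add.subgroupI)
      show "L \<subseteq> carrier ?R" by (auto simp: L_def)
      show "L \<noteq> {}" using zL by auto
      show "\<ominus>\<^bsub>?R\<^esub> p \<in> L" if "p \<in> L" for p
        by (rule inv[OF that])
      show "p \<oplus>\<^bsub>?R\<^esub> q \<in> L" if "p \<in> L" "q \<in> L" for p q
        using aL[OF that] by simp
    qed
  qed (use lL rL in auto)
  moreover have "S \<subseteq> L"
    using S gen by (auto simp: L_def)
  ultimately have "genideal ?R S \<subseteq> L"
    by (rule R.genideal_minimal)
  also have "L \<subseteq> K"
  proof
    fix p assume p: "p \<in> L"
    then have pc: "p \<in> carrier ?R" by (simp add: L_def)
    have "\<one>\<^bsub>?R\<^esub> \<otimes>\<^bsub>?R\<^esub> p \<otimes>\<^bsub>?R\<^esub> \<one>\<^bsub>?R\<^esub> \<in> K"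
      using p by (simp add: L_def)
    then show "p \<in> K" using pc by (simp del: monoid_algebra_simps)
  qed
  finally show ?thesis .
qed

lemma monoid_algebra_mult_diff:
  "(p - p') \<otimes>\<^bsub>monoid_algebra M\<^esub> q = p \<otimes>\<^bsub>monoid_algebra M\<^esub> q - p' \<otimes>\<^bsub>monoid_algebra M\<^esub> q"
  "q \<otimes>\<^bsub>monoid_algebra M\<^esub> (p - p') = q \<otimes>\<^bsub>monoid_algebra M\<^esub> p - q \<otimes>\<^bsub>monoid_algebra M\<^esub> p'"
  using monoid_algebra_mult_add_left[of M "p - p'" p' q]
    monoid_algebra_mult_add_right[of M q "p - p'" p'] by (simp_all add: eq_diff_eq)

lemma quot_algebra_sel:
  "carrier (quot_algebra A J) = carrier (A Quot J)"
  "x \<otimes>\<^bsub>quot_algebra A J\<^esub> y = x \<otimes>\<^bsub>A Quot J\<^esub> y"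
  "\<one>\<^bsub>quot_algebra A J\<^esub> = \<one>\<^bsub>A Quot J\<^esub>"
  "\<zero>\<^bsub>quot_algebra A J\<^esub> = \<zero>\<^bsub>A Quot J\<^esub>"
  "x \<oplus>\<^bsub>quot_algebra A J\<^esub> y = x \<oplus>\<^bsub>A Quot J\<^esub> y"
  "c \<odot>\<^bsub>quot_algebra A J\<^esub> X = (\<Union>x\<in>X. J +>\<^bsub>A\<^esub> (c \<odot>\<^bsub>A\<^esub> x))"
  by (simp_all add: quot_algebra_def ring.extend_def module.fields_def)

locale algebra_ideal = assoc_algebra A + ideal J A
  for A :: "('k::comm_ring_1, 'a) module" (structure) and J :: "'a set"
begin

abbreviation "QA \<equiv> quot_algebra A J"

lemma carrier_quot: "carrier QA = (+>) J ` carrier A"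
  by (auto simp: quot_algebra_sel FactRing_simps)

lemma class_closed [simp, intro]: "x \<in> carrier A \<Longrightarrow> J +> x \<in> carrier QA"
  by (simp add: carrier_quot)

lemma class_add: "x \<in> carrier A \<Longrightarrow> y \<in> carrier A \<Longrightarrow> J +> (x \<oplus> y) = (J +> x) \<oplus>\<^bsub>QA\<^esub> (J +> y)"
  using ring_hom_add[OF rcos_ring_hom] by (simp add: quot_algebra_sel)

lemma class_mult: "x \<in> carrier A \<Longrightarrow> y \<in> carrier A \<Longrightarrow> J +> (x \<otimes> y) = (J +> x) \<otimes>\<^bsub>QA\<^esub> (J +> y)"
  using ring_hom_mult[OF rcos_ring_hom] by (simp add: quot_algebra_sel)

lemma class_one: "J +> \<one> = \<one>\<^bsub>QA\<^esub>"
  using ring_hom_one[OF rcos_ring_hom] by (simp add: quot_algebra_sel)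

lemma class_eq_iff: "x \<in> carrier A \<Longrightarrow> y \<in> carrier A \<Longrightarrow> J +> x = J +> y \<longleftrightarrow> x \<ominus> y \<in> J"
  using quotient_eq_iff_same_a_r_cos[OF is_ideal] by blast

lemma class_zero_iff: "x \<in> carrier A \<Longrightarrow> J +> x = \<zero>\<^bsub>QA\<^esub> \<longleftrightarrow> x \<in> J"
  using a_coset_join1 a_rcos_const[of x] a_rcos_self[of x]
  by (auto simp: quot_algebra_sel FactRing_def)

text \<open>An ideal absorbs scalars because \<open>c x = (c 1) x\<close>.\<close>

lemma ideal_smult: "x \<in> J \<Longrightarrow> c \<odot> x \<in> J"
  using I_l_closed[of x "c \<odot> \<one>"] smult_mult_l[of \<one> x c] by (simp add: a_Hcarr)

lemma class_smult: 
  assumes x: "x \<in> carrier A" shows "J +> (c \<odot> x) = c \<odot>\<^bsub>QA\<^esub> (J +> x)"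
proof -
  have "J +> (c \<odot> y) = J +> (c \<odot> x)" if y: "y \<in> J +> x" for y
  proof -
    obtain h where h: "h \<in> J" "y = h \<oplus> x"
      using y by (auto simp: a_r_coset_def')
    have hc: "h \<in> carrier A" using h by (simp add: a_Hcarr)
    have "c \<odot> y \<ominus> c \<odot> x = c \<odot> h"
      using hc x by (simp add: h smult_r_distr a_minus_def a_assoc r_neg)
    then show ?thesis using h hc x ideal_smult by (subst class_eq_iff) auto
  qed
  moreover have "x \<in> J +> x" using x by (rule a_rcos_self)
  ultimately show ?thesis unfolding quot_algebra_sel by blast
qed

lemma assoc_algebra_quot: "assoc_algebra QA"
proof -
  interpret F: ring "A Quot J" by (rule quotient_is_ring)
  have ag: "abelian_group QA"
  proof (rule abelian_groupI)
    fix x assume "x \<in> carrier QA"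
    then show "\<exists>y\<in>carrier QA. y \<oplus>\<^bsub>QA\<^esub> x = \<zero>\<^bsub>QA\<^esub>"
      using F.l_neg[of x] F.a_inv_closed[of x] by (auto simp: quot_algebra_sel)
  qed (simp_all add: quot_algebra_sel F.a_ac)
  have "ring QA"
  proof (rule ringI[OF ag])
    show "Group.monoid QA"
      by (rule monoidI) (simp_all add: quot_algebra_sel F.m_assoc)
  qed (simp_all add: quot_algebra_sel F.l_distr F.r_distr)
  then show ?thesis
    unfolding assoc_algebra_def assoc_algebra_axioms_def carrier_quot
  proof (intro conjI allI impI; (elim imageE)?; hypsubst?)
  qed (simp_all add: class_add[symmetric] class_mult[symmetric] class_smult[symmetric]
         smult_r_distr smult_l_distr smult_smult smult_mult_l smult_mult_r)
qed

end

section \<open>Tensor products of algebras and of linear maps\<close>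

definition alg_linear :: "('k, 'a) module \<Rightarrow> ('k, 'b) module \<Rightarrow> ('a \<Rightarrow> 'b) \<Rightarrow> bool" where
  "alg_linear A B f \<longleftrightarrow> f \<in> carrier A \<rightarrow> carrier B \<and>
     (\<forall>x\<in>carrier A. \<forall>y\<in>carrier A. f (x \<oplus>\<^bsub>A\<^esub> y) = f x \<oplus>\<^bsub>B\<^esub> f y) \<and>
     (\<forall>c. \<forall>x\<in>carrier A. f (c \<odot>\<^bsub>A\<^esub> x) = c \<odot>\<^bsub>B\<^esub> f x)"

lemma alg_homD:
  assumes "f \<in> alg_hom A B"
  shows "x \<in> carrier A \<Longrightarrow> f x \<in> carrier B"
    and "x \<in> carrier A \<Longrightarrow> y \<in> carrier A \<Longrightarrow> f (x \<otimes>\<^bsub>A\<^esub> y) = f x \<otimes>\<^bsub>B\<^esub> f y"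
    and "x \<in> carrier A \<Longrightarrow> y \<in> carrier A \<Longrightarrow> f (x \<oplus>\<^bsub>A\<^esub> y) = f x \<oplus>\<^bsub>B\<^esub> f y"
    and "f \<one>\<^bsub>A\<^esub> = \<one>\<^bsub>B\<^esub>"
    and "x \<in> carrier A \<Longrightarrow> f (c \<odot>\<^bsub>A\<^esub> x) = c \<odot>\<^bsub>B\<^esub> f x"
  using assms by (auto simp: alg_hom_def ring_hom_closed ring_hom_mult ring_hom_add ring_hom_one)

lemma alg_hom_linear: "f \<in> alg_hom A B \<Longrightarrow> alg_linear A B f"
  by (auto simp: alg_hom_def alg_linear_def ring_hom_closed ring_hom_add)

text \<open>The tensor product of two maps on expressions in pure tensors, before passing to classes.\<close>

definition tensor_push :: "('a \<Rightarrow> 'c) \<Rightarrow> ('b \<Rightarrow> 'd) \<Rightarrow> ('a \<times> 'b \<Rightarrow>\<^sub>0 'k::comm_ring_1) \<Rightarrow> ('c \<times> 'd \<Rightarrow>\<^sub>0 'k)" where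
  "tensor_push f g = linext (\<lambda>(a, b). Poly_Mapping.single (f a, g b))"

lemma tensor_push_zero [simp]: "tensor_push f g 0 = 0"
  by (simp add: tensor_push_def)

lemma tensor_push_add: "tensor_push f g (p + q) = tensor_push f g p + tensor_push f g q"
  unfolding tensor_push_def by (rule linext_add) (auto simp: single_add)

lemma tensor_push_single [simp]:
  "tensor_push f g (Poly_Mapping.single (a, b) c) = Poly_Mapping.single (f a, g b) c"
  by (simp add: tensor_push_def linext_single)

lemma tensor_push_diff: "tensor_push f g (p - q) = tensor_push f g p - tensor_push f g q"
  using tensor_push_add[of f g "p - q" q] by (simp add: eq_diff_eq)

lemma keys_tensor_push:
  assumes "Poly_Mapping.keys p \<subseteq> V \<times> W" "f \<in> V \<rightarrow> V'" "g \<in> W \<rightarrow> W'"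
  shows "Poly_Mapping.keys (tensor_push f g p) \<subseteq> V' \<times> W'"
  unfolding tensor_push_def
  by (rule keys_linext_subset[OF assms(1)]) (use assms(2,3) in \<open>auto split: if_splits\<close>)

locale tensor_pair = A: assoc_algebra A + B: assoc_algebra B
  for A :: "('k::comm_ring_1, 'a) module" and B :: "('k, 'b) module"
begin

abbreviation R :: "('k, 'a \<times> 'b \<Rightarrow>\<^sub>0 'k) module" where "R \<equiv> monoid_algebra (A \<times>\<times> B)"
abbreviation T :: "('k, ('a \<times> 'b \<Rightarrow>\<^sub>0 'k) set) module" where "T \<equiv> tensor_algebra A B"
abbreviation tcl where "tcl \<equiv> tensor_class A B"
abbreviation tens (infixl "\<bullet>" 72) where "a \<bullet> b \<equiv> tensor A B a b"

lemma monoid_prod: "Group.monoid (A \<times>\<times> B)"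
  by (rule DirProd_monoid[OF A.is_monoid B.is_monoid])

sublocale R: assoc_algebra R
  by (rule assoc_algebra_monoid_algebra[OF monoid_prod])

lemma carrier_prod [simp]: "carrier (A \<times>\<times> B) = carrier A \<times> carrier B"
  by (simp add: DirProd_def)

lemma relations_carrier: "tensor_relations A B \<subseteq> carrier R"
proof
  fix s assume "s \<in> tensor_relations A B"
  then show "s \<in> carrier R"
    unfolding tensor_relations_def monoid_algebra_simps mem_Collect_eq Un_iff
    by (elim disjE exE conjE; hypsubst; intro keys_diff_subset) auto
qed

sublocale J: algebra_ideal R "tensor_ideal A B"
  unfolding tensor_ideal_def
  by (intro algebra_ideal.intro R.assoc_algebra_axioms R.genideal_ideal relations_carrier)

sublocale T: assoc_algebra T
  unfolding tensor_algebra_def by (rule J.assoc_algebra_quot)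

lemma carrier_tensor: "carrier T = tcl ` {p. Poly_Mapping.keys p \<subseteq> carrier A \<times> carrier B}"
  unfolding tensor_algebra_def J.carrier_quot by (simp add: tensor_class_def[abs_def])

lemma tensor_class_closed: "Poly_Mapping.keys p \<subseteq> carrier A \<times> carrier B \<Longrightarrow> tcl p \<in> carrier T"
  by (simp add: carrier_tensor)

lemma tensor_class_add:
  "Poly_Mapping.keys p \<subseteq> carrier A \<times> carrier B \<Longrightarrow> Poly_Mapping.keys q \<subseteq> carrier A \<times> carrier B \<Longrightarrow>
    tcl (p + q) = tcl p \<oplus>\<^bsub>T\<^esub> tcl q"
  using J.class_add[of p q] by (simp add: tensor_class_def tensor_algebra_def)

lemma tensor_class_zero [simp]: "tcl 0 = \<zero>\<^bsub>T\<^esub>"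
  using J.class_zero_iff[of 0] J.zero_closed by (simp add: tensor_class_def tensor_algebra_def)

lemma tensor_class_zero_iff:
  "Poly_Mapping.keys p \<subseteq> carrier A \<times> carrier B \<Longrightarrow> tcl p = \<zero>\<^bsub>T\<^esub> \<longleftrightarrow> p \<in> tensor_ideal A B"
  using J.class_zero_iff[of p] by (simp add: tensor_class_def tensor_algebra_def)

lemma tensor_class_diff:
  assumes "Poly_Mapping.keys p \<subseteq> carrier A \<times> carrier B" "Poly_Mapping.keys q \<subseteq> carrier A \<times> carrier B"
  shows "tcl (p - q) = tcl p \<ominus>\<^bsub>T\<^esub> tcl q"
proof -
  have "tcl (p - q) \<oplus>\<^bsub>T\<^esub> tcl q = tcl p"
    using assms tensor_class_add[of "p - q" q] by (simp add: keys_diff_subset)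
  then show ?thesis
    using tensor_class_closed[OF assms(1)] tensor_class_closed[OF assms(2)]
      tensor_class_closed[OF keys_diff_subset[OF assms]]
    by (metis T.add.inv_solve_right T.minus_eq)
qed

lemma tensor_class_mult:
  assumes "Poly_Mapping.keys p \<subseteq> carrier A \<times> carrier B" "Poly_Mapping.keys q \<subseteq> carrier A \<times> carrier B"
  shows "tcl (p \<otimes>\<^bsub>R\<^esub> q) = tcl p \<otimes>\<^bsub>T\<^esub> tcl q"
  using assms J.class_mult[of p q] by (simp add: tensor_class_def tensor_algebra_def)

lemma tensor_class_scale:
  assumes "Poly_Mapping.keys p \<subseteq> carrier A \<times> carrier B"
  shows "tcl (Poly_Mapping.map ((*) c) p) = c \<odot>\<^bsub>T\<^esub> tcl p"
  using assms J.class_smult[of p c] by (simp add: tensor_class_def tensor_algebra_def)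

lemma tensor_closed [simp, intro]: "a \<in> carrier A \<Longrightarrow> b \<in> carrier B \<Longrightarrow> a \<bullet> b \<in> carrier T"
  by (simp add: tensor_def tensor_class_closed)

lemma relation_class: 
  assumes "s \<in> tensor_relations A B" shows "tcl s = \<zero>\<^bsub>T\<^esub>"
  using assms R.genideal_self[OF relations_carrier] relations_carrier
  by (subst tensor_class_zero_iff) (auto simp: tensor_ideal_def)

lemma tensor_add_left:
  assumes "a \<in> carrier A" "a' \<in> carrier A" "b \<in> carrier B"
  shows "(a \<oplus>\<^bsub>A\<^esub> a') \<bullet> b = a \<bullet> b \<oplus>\<^bsub>T\<^esub> a' \<bullet> b"
proof -
  have "Poly_Mapping.single (a \<oplus>\<^bsub>A\<^esub> a', b) 1 - Poly_Mapping.single (a, b) 1 - Poly_Mapping.single (a', b) 1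
      \<in> tensor_relations A B"
    unfolding tensor_relations_def using assms by blast
  from relation_class[OF this] have "(a \<oplus>\<^bsub>A\<^esub> a') \<bullet> b \<ominus>\<^bsub>T\<^esub> a \<bullet> b \<ominus>\<^bsub>T\<^esub> a' \<bullet> b = \<zero>\<^bsub>T\<^esub>"
    using assms by (simp add: tensor_class_diff keys_diff_subset tensor_def)
  then show ?thesis
    by (rule T.minus_minus_eq_zeroD) (use assms in auto)
qed

lemma tensor_add_right:
  assumes "a \<in> carrier A" "b \<in> carrier B" "b' \<in> carrier B"
  shows "a \<bullet> (b \<oplus>\<^bsub>B\<^esub> b') = a \<bullet> b \<oplus>\<^bsub>T\<^esub> a \<bullet> b'"
proof -
  have "Poly_Mapping.single (a, b \<oplus>\<^bsub>B\<^esub> b') 1 - Poly_Mapping.single (a, b) 1 - Poly_Mapping.single (a, b') 1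
      \<in> tensor_relations A B"
    unfolding tensor_relations_def using assms by blast
  from relation_class[OF this] have "a \<bullet> (b \<oplus>\<^bsub>B\<^esub> b') \<ominus>\<^bsub>T\<^esub> a \<bullet> b \<ominus>\<^bsub>T\<^esub> a \<bullet> b' = \<zero>\<^bsub>T\<^esub>"
    using assms by (simp add: tensor_class_diff keys_diff_subset tensor_def)
  then show ?thesis
    by (rule T.minus_minus_eq_zeroD) (use assms in auto)
qed

lemma tensor_class_single:
  assumes "a \<in> carrier A" "b \<in> carrier B"
  shows "tcl (Poly_Mapping.single (a, b) c) = c \<odot>\<^bsub>T\<^esub> (a \<bullet> b)"
  using tensor_class_scale[of "Poly_Mapping.single (a, b) 1" c] assms by (simp add: tensor_def)

lemma tensor_smult_left:
  assumes "a \<in> carrier A" "b \<in> carrier B"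
  shows "(c \<odot>\<^bsub>A\<^esub> a) \<bullet> b = c \<odot>\<^bsub>T\<^esub> (a \<bullet> b)"
proof -
  have "Poly_Mapping.single (c \<odot>\<^bsub>A\<^esub> a, b) 1 - Poly_Mapping.single (a, b) c \<in> tensor_relations A B"
    unfolding tensor_relations_def using assms by blast
  from relation_class[OF this] have "(c \<odot>\<^bsub>A\<^esub> a) \<bullet> b \<ominus>\<^bsub>T\<^esub> c \<odot>\<^bsub>T\<^esub> (a \<bullet> b) = \<zero>\<^bsub>T\<^esub>"
    using assms by (simp add: tensor_class_diff tensor_class_single)
  then show ?thesis
    using assms by (subst (asm) T.minus_eq_zero_iff) auto
qed

lemma tensor_smult_right:
  assumes "a \<in> carrier A" "b \<in> carrier B"
  shows "a \<bullet> (c \<odot>\<^bsub>B\<^esub> b) = c \<odot>\<^bsub>T\<^esub> (a \<bullet> b)"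
proof -
  have "Poly_Mapping.single (a, c \<odot>\<^bsub>B\<^esub> b) 1 - Poly_Mapping.single (a, b) c \<in> tensor_relations A B"
    unfolding tensor_relations_def using assms by blast
  from relation_class[OF this] have "a \<bullet> (c \<odot>\<^bsub>B\<^esub> b) \<ominus>\<^bsub>T\<^esub> c \<odot>\<^bsub>T\<^esub> (a \<bullet> b) = \<zero>\<^bsub>T\<^esub>"
    using assms by (simp add: tensor_class_diff tensor_class_single)
  then show ?thesis
    using assms by (subst (asm) T.minus_eq_zero_iff) auto
qed

lemma tensor_mult:
  assumes "a \<in> carrier A" "b \<in> carrier B" "a' \<in> carrier A" "b' \<in> carrier B"
  shows "(a \<bullet> b) \<otimes>\<^bsub>T\<^esub> (a' \<bullet> b') = (a \<otimes>\<^bsub>A\<^esub> a') \<bullet> (b \<otimes>\<^bsub>B\<^esub> b')"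
  using assms by (simp add: tensor_def tensor_class_mult[symmetric])

lemma tensor_one: "\<one>\<^bsub>T\<^esub> = \<one>\<^bsub>A\<^esub> \<bullet> \<one>\<^bsub>B\<^esub>"
  using J.class_one by (simp add: tensor_def tensor_class_def tensor_algebra_def)

lemma tensor_zero_left [simp]: "b \<in> carrier B \<Longrightarrow> \<zero>\<^bsub>A\<^esub> \<bullet> b = \<zero>\<^bsub>T\<^esub>"
  using tensor_smult_left[of "\<zero>\<^bsub>A\<^esub>" b 0] by simp

lemma tensor_zero_right [simp]: "a \<in> carrier A \<Longrightarrow> a \<bullet> \<zero>\<^bsub>B\<^esub> = \<zero>\<^bsub>T\<^esub>"
  using tensor_smult_right[of a "\<zero>\<^bsub>B\<^esub>" 0] by simp

text \<open>Sums of pure tensors exhaust the tensor product without any coefficients, since a scalar can be moved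
into the first factor.\<close>

lemma tensor_induct [consumes 1, case_names pure add]:
  assumes "z \<in> carrier T"
    and pure: "\<And>a b. a \<in> carrier A \<Longrightarrow> b \<in> carrier B \<Longrightarrow> P (a \<bullet> b)"
    and add: "\<And>x y. x \<in> carrier T \<Longrightarrow> y \<in> carrier T \<Longrightarrow> P x \<Longrightarrow> P y \<Longrightarrow> P (x \<oplus>\<^bsub>T\<^esub> y)"
  shows "P z"
proof -
  obtain p where p: "Poly_Mapping.keys p \<subseteq> carrier A \<times> carrier B" and z: "z = tcl p"
    using assms(1) by (auto simp: carrier_tensor)
  have "P (tcl p)"
    using p
  proof (induction p rule: poly_mapping_add_induct)
    case zero
    show ?case using pure[of "\<zero>\<^bsub>A\<^esub>" "\<zero>\<^bsub>B\<^esub>"] by simp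
  next
    case (single s c)
    then obtain a b where s: "s = (a, b)" "a \<in> carrier A" "b \<in> carrier B" by auto
    have "tcl (Poly_Mapping.single s c) = (c \<odot>\<^bsub>A\<^esub> a) \<bullet> b"
      using s by (simp add: tensor_class_single tensor_smult_left)
    then show ?case using pure s by simp
  next
    case (add p q)
    then show ?case by (simp add: tensor_class_add tensor_class_closed assms(3))
  qed
  then show ?thesis by (simp add: z)
qed

end

locale tensor_functor =
  S: tensor_pair A B + S': tensor_pair A' B'
  for A :: "('k::comm_ring_1, 'a) module" and B :: "('k, 'b) module"
    and A' :: "('k, 'c) module" and B' :: "('k, 'd) module" +
  fixes f :: "'a \<Rightarrow> 'c" and g :: "'b \<Rightarrow> 'd"
  assumes f: "alg_linear A A' f" and g: "alg_linear B B' g"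
begin

lemma f_closed [simp]: "a \<in> carrier A \<Longrightarrow> f a \<in> carrier A'"
  and g_closed [simp]: "b \<in> carrier B \<Longrightarrow> g b \<in> carrier B'"
  using f g by (auto simp: alg_linear_def)

lemma f_add: "a \<in> carrier A \<Longrightarrow> a' \<in> carrier A \<Longrightarrow> f (a \<oplus>\<^bsub>A\<^esub> a') = f a \<oplus>\<^bsub>A'\<^esub> f a'"
  and f_smult: "a \<in> carrier A \<Longrightarrow> f (c \<odot>\<^bsub>A\<^esub> a) = c \<odot>\<^bsub>A'\<^esub> f a"
  and g_add: "b \<in> carrier B \<Longrightarrow> b' \<in> carrier B \<Longrightarrow> g (b \<oplus>\<^bsub>B\<^esub> b') = g b \<oplus>\<^bsub>B'\<^esub> g b'"
  and g_smult: "b \<in> carrier B \<Longrightarrow> g (c \<odot>\<^bsub>B\<^esub> b) = c \<odot>\<^bsub>B'\<^esub> g b"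
  using f g by (auto simp: alg_linear_def)

abbreviation push where "push \<equiv> tensor_push f g"

lemma keys_push:
  "Poly_Mapping.keys p \<subseteq> carrier A \<times> carrier B \<Longrightarrow> Poly_Mapping.keys (push p) \<subseteq> carrier A' \<times> carrier B'"
  by (rule keys_tensor_push) auto

text \<open>A product of a bilinearity relation with pure tensors on both sides is a scalar multiple of a bilinearity
relation.  So the ideal of relations is just their linear span, and linearity of \<open>f\<close> and \<open>g\<close>, without
multiplicativity, makes \<open>f \<otimes> g\<close> well defined.\<close>

lemma push_ideal:
  assumes p: "p \<in> tensor_ideal A B"
  shows "S'.tcl (push p) = \<zero>\<^bsub>S'.T\<^esub>"
proof -
  define K where "K = {p. Poly_Mapping.keys p \<subseteq> carrier A \<times> carrier B \<and> S'.tcl (push p) = \<zero>\<^bsub>S'.T\<^esub>}"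
  have "tensor_ideal A B \<subseteq> K"
    unfolding tensor_ideal_def
  proof (rule genideal_monoid_algebra_subset[OF S.monoid_prod S.relations_carrier])
    show "0 \<in> K" by (simp add: K_def)
    show "p + q \<in> K" if "p \<in> K" "q \<in> K" for p q
      using that by (simp add: K_def keys_add_subset tensor_push_add S'.tensor_class_add keys_push)
    fix m n c s
    assume "m \<in> carrier (A \<times>\<times> B)" "n \<in> carrier (A \<times>\<times> B)" and s: "s \<in> tensor_relations A B"
    then obtain m1 m2 n1 n2 where mn: "m = (m1, m2)" "n = (n1, n2)"
      and c: "m1 \<in> carrier A" "n1 \<in> carrier A" "m2 \<in> carrier B" "n2 \<in> carrier B"
      by auto
    note simps = monoid_algebra_mult_diff keys_diff_subset tensor_push_diff
      S.A.l_distr S.A.r_distr S.B.l_distr S.B.r_distr S.A.smult_mult_l S.A.smult_mult_r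
      S.B.smult_mult_l S.B.smult_mult_r f_add g_add f_smult g_smult S'.tensor_class_diff
      S'.tensor_class_single S'.tensor_add_left S'.tensor_add_right S'.tensor_smult_left S'.tensor_smult_right
      S'.T.smult_r_distr S'.T.smult_smult
    from s show "Poly_Mapping.single m c \<otimes>\<^bsub>S.R\<^esub> s \<otimes>\<^bsub>S.R\<^esub> Poly_Mapping.single n 1 \<in> K"
      unfolding tensor_relations_def K_def mn
      by (elim UnE; clarsimp simp: c simps S'.T.add_minus_minus_zero S'.T.minus_eq_zero_iff)
  qed
  with p show ?thesis by (auto simp: K_def)
qed

text \<open>The representative is chosen arbitrarily: two of them differ by an element of the ideal, which \<open>push\<close> sends to
zero.\<close>

definition lift :: "('a \<times> 'b \<Rightarrow>\<^sub>0 'k) set \<Rightarrow> ('c \<times> 'd \<Rightarrow>\<^sub>0 'k) set" where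
  "lift z = S'.tcl (push (SOME p. Poly_Mapping.keys p \<subseteq> carrier A \<times> carrier B \<and> z = S.tcl p))"

lemma lift_class:
  assumes p: "Poly_Mapping.keys p \<subseteq> carrier A \<times> carrier B"
  shows "lift (S.tcl p) = S'.tcl (push p)"
proof -
  define q where "q = (SOME q. Poly_Mapping.keys q \<subseteq> carrier A \<times> carrier B \<and> S.tcl p = S.tcl q)"
  have q: "Poly_Mapping.keys q \<subseteq> carrier A \<times> carrier B \<and> S.tcl p = S.tcl q"
    unfolding q_def by (rule someI[of _ p]) (use p in simp)
  have "S.tcl (q - p) = \<zero>\<^bsub>S.T\<^esub>"
    using p q S.T.minus_eq_zero_iff S.tensor_class_closed[OF p] by (simp add: S.tensor_class_diff)
  then have "q - p \<in> tensor_ideal A B"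
    using S.tensor_class_zero_iff keys_diff_subset p q by blast
  then have "S'.tcl (push q) \<ominus>\<^bsub>S'.T\<^esub> S'.tcl (push p) = \<zero>\<^bsub>S'.T\<^esub>"
    using push_ideal[of "q - p"] p q by (simp add: tensor_push_diff S'.tensor_class_diff keys_push)
  then have "S'.tcl (push q) = S'.tcl (push p)"
    using p q keys_push by (subst (asm) S'.T.minus_eq_zero_iff) (auto intro: S'.tensor_class_closed)
  then show ?thesis
    by (simp add: lift_def q_def[symmetric])
qed

lemma lift_tensor: "a \<in> carrier A \<Longrightarrow> b \<in> carrier B \<Longrightarrow> lift (tensor A B a b) = tensor A' B' (f a) (g b)"
  by (simp add: tensor_def lift_class)

lemma lift_closed [simp, intro]: "z \<in> carrier S.T \<Longrightarrow> lift z \<in> carrier S'.T"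
  by (auto simp: S.carrier_tensor lift_class keys_push S'.tensor_class_closed)

lemma lift_add:
  assumes "x \<in> carrier S.T" "y \<in> carrier S.T"
  shows "lift (x \<oplus>\<^bsub>S.T\<^esub> y) = lift x \<oplus>\<^bsub>S'.T\<^esub> lift y"
  using assms
  by (auto simp: S.carrier_tensor S.tensor_class_add[symmetric] lift_class keys_add_subset
      tensor_push_add S'.tensor_class_add keys_push)

lemma lift_smult:
  assumes "x \<in> carrier S.T"
  shows "lift (c \<odot>\<^bsub>S.T\<^esub> x) = c \<odot>\<^bsub>S'.T\<^esub> lift x"
  using assms
proof (induction x rule: S.tensor_induct)
  case (pure a b)
  then show ?case
    by (simp add: S.tensor_smult_left[symmetric] lift_tensor f_smult S'.tensor_smult_left)
qed (simp add: S.T.smult_r_distr lift_add S'.T.smult_r_distr)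

lemma lift_zero [simp]: "lift \<zero>\<^bsub>S.T\<^esub> = \<zero>\<^bsub>S'.T\<^esub>"
  using lift_class[of 0] by simp

end

text \<open>On the image of \<open>V \<otimes> W\<close> the map defined by arbitrary expressions in \<open>V \<times> W\<close> is the restriction of the
global map \<open>f \<otimes> g\<close>.  The latter depends on the class only, which is why the description has a unique
solution.\<close>

lemma tensor_map_eq_lift:
  fixes A :: "('k::field, 'a) module"
  assumes "tensor_functor A B A' B' f g"
    and V: "V \<subseteq> carrier A" and W: "W \<subseteq> carrier B"
    and z: "z \<in> tensor_subspace A B V W"
  shows "tensor_map A B A' B' V W (restrict f V) (restrict g W) z = tensor_functor.lift A B A' B' f g z"
proof -
  interpret tensor_functor A B A' B' f g by fact
  have sum: "(\<Sum>(a, b)\<in>Poly_Mapping.keys p. Poly_Mapping.single (restrict f V a, restrict g W b) (Poly_Mapping.lookup p (a, b)))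
      = push p" if "Poly_Mapping.keys p \<subseteq> V \<times> W" for p
    unfolding tensor_push_def linext_def
    using that by (intro sum.cong refl) (auto split: prod.splits)
  have sub: "V \<times> W \<subseteq> carrier A \<times> carrier B" using V W by blast
  obtain p where p: "Poly_Mapping.keys p \<subseteq> V \<times> W" "z = S.tcl p"
    using z by (auto simp: tensor_subspace_def)
  have eq: "S'.tcl (push q) = lift z" if "Poly_Mapping.keys q \<subseteq> V \<times> W" "z = S.tcl q" for q
    using that sub by (simp add: lift_class)
  have "(THE z'. \<exists>p. Poly_Mapping.keys p \<subseteq> V \<times> W \<and> z = S.tcl p \<and>
          z' = S'.tcl (\<Sum>(a, b)\<in>Poly_Mapping.keys p. Poly_Mapping.single (restrict f V a, restrict g W b) (Poly_Mapping.lookup p (a, b))))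
      = lift z"
  proof (rule the_equality)
    show "\<exists>p. Poly_Mapping.keys p \<subseteq> V \<times> W \<and> z = S.tcl p \<and>
          lift z = S'.tcl (\<Sum>(a, b)\<in>Poly_Mapping.keys p. Poly_Mapping.single (restrict f V a, restrict g W b) (Poly_Mapping.lookup p (a, b)))"
      using p eq[OF p] sum[OF p(1)] by (intro exI[of _ p]) simp
  next
    fix z' assume "\<exists>p. Poly_Mapping.keys p \<subseteq> V \<times> W \<and> z = S.tcl p \<and>
          z' = S'.tcl (\<Sum>(a, b)\<in>Poly_Mapping.keys p. Poly_Mapping.single (restrict f V a, restrict g W b) (Poly_Mapping.lookup p (a, b)))"
    then obtain q where q: "Poly_Mapping.keys q \<subseteq> V \<times> W" "z = S.tcl q"
      and z': "z' = S'.tcl (\<Sum>(a, b)\<in>Poly_Mapping.keys q. Poly_Mapping.single (restrict f V a, restrict g W b) (Poly_Mapping.lookup q (a, b)))"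
      by blast
    show "z' = lift z" unfolding z' sum[OF q(1)] by (rule eq[OF q])
  qed
  then show ?thesis using z by (simp add: tensor_map_def)
qed

section \<open>Gradings and projections to components\<close>

text \<open>A grading is given together with its projections.  The existence of linear projections that fix one component
and kill the others expresses that the sum of the components is direct; \<open>spanned\<close> expresses that it is
everything.\<close>

locale graded_space = assoc_algebra A for A :: "('k::comm_ring_1, 'a) module" (structure) +
  fixes M :: "'g \<Rightarrow> 'a set" and \<pi> :: "'g \<Rightarrow> 'a \<Rightarrow> 'a"
  assumes component_subset: "M g \<subseteq> carrier A"
    and proj_linear: "alg_linear A A (\<pi> g)"
    and proj_in_component: "x \<in> carrier A \<Longrightarrow> \<pi> g x \<in> M g"
    and proj_same: "x \<in> M g \<Longrightarrow> \<pi> g x = x"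
    and proj_other: "x \<in> M g \<Longrightarrow> h \<noteq> g \<Longrightarrow> \<pi> h x = \<zero>"
    and spanned: "x \<in> carrier A \<Longrightarrow> (\<And>g y. y \<in> M g \<Longrightarrow> P y) \<Longrightarrow>
       (\<And>y z. y \<in> carrier A \<Longrightarrow> z \<in> carrier A \<Longrightarrow> P y \<Longrightarrow> P z \<Longrightarrow> P (y \<oplus> z)) \<Longrightarrow> P x"
begin

lemma proj_closed [simp, intro]: "x \<in> carrier A \<Longrightarrow> \<pi> g x \<in> carrier A"
  and proj_add: "x \<in> carrier A \<Longrightarrow> y \<in> carrier A \<Longrightarrow> \<pi> g (x \<oplus> y) = \<pi> g x \<oplus> \<pi> g y"
  and proj_smult: "x \<in> carrier A \<Longrightarrow> \<pi> g (c \<odot> x) = c \<odot> \<pi> g x"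
  using proj_linear[of g] by (auto simp: alg_linear_def Pi_iff)

lemma proj_zero [simp]: "\<pi> g \<zero> = \<zero>"
  using proj_smult[of \<zero> g 0] by simp

lemma proj_finsum:
  assumes "finite H" "f \<in> H \<rightarrow> carrier A"
  shows "\<pi> g (\<Oplus>h\<in>H. f h) = (\<Oplus>h\<in>H. \<pi> g (f h))"
  using assms by (induction H rule: finite_induct) (simp_all add: proj_add Pi_def finsum_closed)

text \<open>The index set \<open>H\<close> may contain indices of zero components: this lets the index sets of two summands be
replaced by their union.\<close>

lemma decomposition:
  assumes "x \<in> carrier A"
  shows "\<exists>H. finite H \<and> (\<forall>h. h \<notin> H \<longrightarrow> \<pi> h x = \<zero>) \<and> x = (\<Oplus>h\<in>H. \<pi> h x)"
  using assms
proof (rule spanned)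
  fix g y assume y: "y \<in> M g"
  then have yc: "y \<in> carrier A" using component_subset by blast
  have "(\<Oplus>h\<in>{g}. \<pi> h y) = y"
    using y yc by (simp add: proj_same)
  then show "\<exists>H. finite H \<and> (\<forall>h. h \<notin> H \<longrightarrow> \<pi> h y = \<zero>) \<and> y = (\<Oplus>h\<in>H. \<pi> h y)"
    using y by (intro exI[of _ "{g}"]) (auto simp: proj_other)
next
  fix y z assume yc: "y \<in> carrier A" and zc: "z \<in> carrier A"
    and "\<exists>H. finite H \<and> (\<forall>h. h \<notin> H \<longrightarrow> \<pi> h y = \<zero>) \<and> y = (\<Oplus>h\<in>H. \<pi> h y)"
    and "\<exists>H. finite H \<and> (\<forall>h. h \<notin> H \<longrightarrow> \<pi> h z = \<zero>) \<and> z = (\<Oplus>h\<in>H. \<pi> h z)"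
  then obtain H H' where H: "finite H" "\<And>h. h \<notin> H \<Longrightarrow> \<pi> h y = \<zero>" "y = (\<Oplus>h\<in>H. \<pi> h y)"
    and H': "finite H'" "\<And>h. h \<notin> H' \<Longrightarrow> \<pi> h z = \<zero>" "z = (\<Oplus>h\<in>H'. \<pi> h z)"
    by blast
  have "y = (\<Oplus>h\<in>H \<union> H'. \<pi> h y)"
    using H H' yc by (subst H(3), intro add.finprod_mono_neutral_cong_left) auto
  moreover have "z = (\<Oplus>h\<in>H \<union> H'. \<pi> h z)"
    using H H' zc by (subst H'(3), intro add.finprod_mono_neutral_cong_left) auto
  moreover have "(\<Oplus>h\<in>H \<union> H'. \<pi> h (y \<oplus> z)) = (\<Oplus>h\<in>H \<union> H'. \<pi> h y) \<oplus> (\<Oplus>h\<in>H \<union> H'. \<pi> h z)"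
    using yc zc H(1) H'(1) by (simp add: proj_add finsum_addf Pi_def)
  moreover have "\<forall>h. h \<notin> H \<union> H' \<longrightarrow> \<pi> h (y \<oplus> z) = \<zero>"
    using H(2) H'(2) yc zc by (simp add: proj_add)
  ultimately have "y \<oplus> z = (\<Oplus>h\<in>H \<union> H'. \<pi> h (y \<oplus> z))" by simp
  then show "\<exists>K. finite K \<and> (\<forall>h. h \<notin> K \<longrightarrow> \<pi> h (y \<oplus> z) = \<zero>) \<and> y \<oplus> z = (\<Oplus>h\<in>K. \<pi> h (y \<oplus> z))"
    using H(1) H'(1) \<open>\<forall>h. h \<notin> H \<union> H' \<longrightarrow> \<pi> h (y \<oplus> z) = \<zero>\<close> by (intro exI[of _ "H \<union> H'"]) blast
qed

text \<open>The component of an element is unique, since applying \<open>\<pi> g\<close> to any decomposition returns its summand at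
\<open>g\<close>.\<close>

lemma direct_sum_proj_eq:
  assumes x: "x \<in> carrier A"
  shows "direct_sum_proj A M g x = \<pi> g x"
  unfolding direct_sum_proj_def
proof (rule the_equality)
  obtain H where H: "finite H" "\<And>h. h \<notin> H \<Longrightarrow> \<pi> h x = \<zero>" "x = (\<Oplus>h\<in>H. \<pi> h x)"
    using decomposition[OF x] by blast
  have sub: "{h. \<pi> h x \<noteq> \<zero>} \<subseteq> H" using H(2) by blast
  have "(\<Oplus>h\<in>{h. \<pi> h x \<noteq> \<zero>}. \<pi> h x) = (\<Oplus>h\<in>H. \<pi> h x)"
    using sub H(1) x by (intro add.finprod_mono_neutral_cong_left) auto
  then show "\<exists>f. (\<forall>h. f h \<in> M h) \<and> finite {h. f h \<noteq> \<zero>} \<and> x = (\<Oplus>h\<in>{h. f h \<noteq> \<zero>}. f h) \<and> \<pi> g x = f g"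
    using sub H x by (intro exI[of _ "\<lambda>h. \<pi> h x"]) (auto simp: proj_in_component intro: finite_subset)
next
  fix y assume "\<exists>f. (\<forall>h. f h \<in> M h) \<and> finite {h. f h \<noteq> \<zero>} \<and> x = (\<Oplus>h\<in>{h. f h \<noteq> \<zero>}. f h) \<and> y = f g"
  then obtain f where f: "\<And>h. f h \<in> M h" "finite {h. f h \<noteq> \<zero>}" "x = (\<Oplus>h\<in>{h. f h \<noteq> \<zero>}. f h)" "y = f g"
    by blast
  let ?S = "{h. f h \<noteq> \<zero>}"
  have fc: "f h \<in> carrier A" for h using f(1) component_subset by blast
  have "\<pi> g x = (\<Oplus>h\<in>?S. \<pi> g (f h))"
    using f(2,3) fc by (simp add: proj_finsum)
  also have "\<dots> = (\<Oplus>h\<in>insert g ?S. if g = h then f h else \<zero>)"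
    using f(1,2) fc by (intro add.finprod_mono_neutral_cong_left) (auto simp: proj_same[OF f(1)] proj_other[OF f(1)])
  also have "\<dots> = f g"
    using f(2) fc by (intro finsum_singleton) auto
  finally show "y = \<pi> g x" by (simp add: f(4))
qed

end

text \<open>The tensor product of two graded spaces is graded by pairs, with projections \<open>\<pi> g \<otimes> \<rho> h\<close>.\<close>

locale tensor_graded =
  A: graded_space A M \<pi> + B: graded_space B N \<rho>
  for A :: "('k::field, 'a) module" and M :: "'g \<Rightarrow> 'a set" and \<pi>
    and B :: "('k, 'b) module" and N :: "'h \<Rightarrow> 'b set" and \<rho>
begin

sublocale tensor_pair A B ..

lemma proj_functor: "tensor_functor A B A B (\<pi> g) (\<rho> h)"
  by (intro tensor_functor.intro tensor_pair_axioms tensor_functor_axioms.intro A.proj_linear B.proj_linear)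

definition tproj :: "'g \<times> 'h \<Rightarrow> ('a \<times> 'b \<Rightarrow>\<^sub>0 'k) set \<Rightarrow> ('a \<times> 'b \<Rightarrow>\<^sub>0 'k) set" where
  "tproj = (\<lambda>(g, h). tensor_functor.lift A B A B (\<pi> g) (\<rho> h))"

lemma tproj_tensor:
  "a \<in> carrier A \<Longrightarrow> b \<in> carrier B \<Longrightarrow> tproj (g, h) (a \<bullet> b) = \<pi> g a \<bullet> \<rho> h b"
  by (simp add: tproj_def tensor_functor.lift_tensor[OF proj_functor])

lemma tproj_class:
  "Poly_Mapping.keys p \<subseteq> carrier A \<times> carrier B \<Longrightarrow> tproj (g, h) (tcl p) = tcl (tensor_push (\<pi> g) (\<rho> h) p)"
  by (simp add: tproj_def tensor_functor.lift_class[OF proj_functor])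

sublocale T: graded_space T "\<lambda>(g, h). tensor_subspace A B (M g) (N h)" tproj
proof (unfold_locales, goal_cases)
  case (1 gh)
  obtain g h where gh: "gh = (g, h)" by force
  have "M g \<times> N h \<subseteq> carrier A \<times> carrier B"
    using A.component_subset B.component_subset by blast
  then show ?case unfolding gh
    by (auto simp: tensor_subspace_def tensor_class_closed)
next
  case (2 gh)
  obtain g h where gh: "gh = (g, h)" by force
  interpret L: tensor_functor A B A B "\<pi> g" "\<rho> h" by (rule proj_functor)
  show ?case unfolding gh tproj_def alg_linear_def
    by (auto simp: L.lift_add L.lift_smult)
next
  case (3 x gh)
  obtain g h where gh: "gh = (g, h)" by force
  obtain p where p: "Poly_Mapping.keys p \<subseteq> carrier A \<times> carrier B" "x = tcl p"
    using 3 by (auto simp: carrier_tensor)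
  have "Poly_Mapping.keys (tensor_push (\<pi> g) (\<rho> h) p) \<subseteq> M g \<times> N h"
    by (rule keys_tensor_push[OF p(1)]) (auto simp: A.proj_in_component B.proj_in_component)
  then show ?case unfolding gh using p
    by (auto simp: tproj_class tensor_subspace_def)
next
  case (4 x gh)
  obtain g h where gh: "gh = (g, h)" by force
  obtain p where p: "Poly_Mapping.keys p \<subseteq> M g \<times> N h" "x = tcl p"
    using 4 gh by (auto simp: tensor_subspace_def)
  have "M g \<times> N h \<subseteq> carrier A \<times> carrier B"
    using A.component_subset B.component_subset by blast
  with p have pc: "Poly_Mapping.keys p \<subseteq> carrier A \<times> carrier B" by blast
  have "tensor_push (\<pi> g) (\<rho> h) p = p"
    using p(1) by (induction p rule: poly_mapping_add_induct)
      (auto simp: tensor_push_add A.proj_same B.proj_same)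
  then show ?case unfolding gh p(2) by (simp add: tproj_class pc)
next
  case (5 x gh gh')
  obtain g h where gh: "gh = (g, h)" by force
  obtain g' h' where gh': "gh' = (g', h')" by force
  obtain p where p: "Poly_Mapping.keys p \<subseteq> M g \<times> N h" "x = tcl p"
    using 5 gh by (auto simp: tensor_subspace_def)
  have sub: "M g \<times> N h \<subseteq> carrier A \<times> carrier B"
    using A.component_subset B.component_subset by blast
  with p have pc: "Poly_Mapping.keys p \<subseteq> carrier A \<times> carrier B" by blast
  interpret L: tensor_functor A B A B "\<pi> g'" "\<rho> h'" by (rule proj_functor)
  have "tcl (tensor_push (\<pi> g') (\<rho> h') p) = \<zero>\<^bsub>T\<^esub>"
    using p(1)
  proof (induction p rule: poly_mapping_add_induct)
    case (single s c)
    then obtain a b where s: "s = (a, b)" "a \<in> M g" "b \<in> N h" by auto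
    then have ab: "a \<in> carrier A" "b \<in> carrier B" using sub by auto
    have "\<pi> g' a \<bullet> \<rho> h' b = \<zero>\<^bsub>T\<^esub>"
      using \<open>gh' \<noteq> gh\<close> s ab unfolding gh gh'
      by (cases "g' = g") (auto simp: A.proj_other B.proj_other)
    then show ?case using s ab by (simp add: tensor_class_single)
  next
    case (add p q)
    have "Poly_Mapping.keys p \<subseteq> carrier A \<times> carrier B" "Poly_Mapping.keys q \<subseteq> carrier A \<times> carrier B"
      using add sub by blast+
    with add show ?case by (simp add: tensor_push_add tensor_class_add L.keys_push)
  qed simp
  then show ?case unfolding gh' p(2) by (simp add: tproj_class pc)
next
  case (6 x P)
  have hom: "P y" if "y \<in> tensor_subspace A B (M g) (N h)" for y g h
    by (rule 6(2)[where g = "(g, h)"]) (use that in simp)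
  note add = 6(3)
  have pure: "P (a \<bullet> b)" if "a \<in> M g" "b \<in> N h" for a b g h
    by (rule hom[where g = g and h = h])
      (use that in \<open>auto simp: tensor_subspace_def tensor_def intro!: image_eqI[where x="Poly_Mapping.single (a, b) 1"]\<close>)
  have left: "P (a \<bullet> b)" if "a \<in> carrier A" "b \<in> N h" for a b h
  proof -
    have b: "b \<in> carrier B" using that B.component_subset by blast
    show ?thesis using that(1)
      by (rule A.spanned) (use pure that b add in \<open>auto simp: tensor_add_left\<close>)
  qed
  have "P (a \<bullet> b)" if a: "a \<in> carrier A" and b: "b \<in> carrier B" for a b
    using b by (rule B.spanned) (use left a add in \<open>auto simp: tensor_add_right\<close>)
  with 6(1) show ?case by (rule tensor_induct) (assumption | rule add)+
qed

end

section \<open>The grading of the quantum group\<close>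

lemma monoid_free_monoid: "Group.monoid (free_monoid G)"
  by (rule monoidI) (auto simp: free_monoid_def)

definition word_degree :: "('j, 'y) gen list \<Rightarrow> ('j \<Rightarrow>\<^sub>0 int)" where
  "word_degree w = sum_list (map gen_degree w)"

lemma word_degree_simps [simp]:
  "word_degree [] = 0" "word_degree (g # w) = gen_degree g + word_degree w"
  "word_degree (w @ w') = word_degree w + word_degree w'"
  by (simp_all add: word_degree_def)

definition free_proj :: "('j \<Rightarrow>\<^sub>0 int) \<Rightarrow> (('j, 'y) gen list \<Rightarrow>\<^sub>0 qv) \<Rightarrow> (('j, 'y) gen list \<Rightarrow>\<^sub>0 qv)" where
  "free_proj \<nu> = linext (\<lambda>w c. if word_degree w = \<nu> then Poly_Mapping.single w c else 0)"

lemma free_proj_zero [simp]: "free_proj \<nu> 0 = 0"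
  by (simp add: free_proj_def)

lemma free_proj_add: "free_proj \<nu> (p + q) = free_proj \<nu> p + free_proj \<nu> q"
  unfolding free_proj_def by (rule linext_add) (simp add: single_add)

lemma free_proj_single [simp]:
  "free_proj \<nu> (Poly_Mapping.single w c) = (if word_degree w = \<nu> then Poly_Mapping.single w c else 0)"
  by (simp add: free_proj_def linext_single)

lemma keys_free_proj: "Poly_Mapping.keys (free_proj \<nu> p) \<subseteq> Poly_Mapping.keys p \<inter> {w. word_degree w = \<nu>}"
  unfolding free_proj_def
  by (rule order_trans[OF keys_linext_subset[OF order_refl, where T = "Poly_Mapping.keys p \<inter> {w. word_degree w = \<nu>}"]])
    (auto split: if_splits)

lemma free_proj_homogeneous:
  assumes "Poly_Mapping.keys p \<subseteq> {w. word_degree w = \<mu>}"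
  shows "free_proj \<nu> p = (if \<mu> = \<nu> then p else 0)"
  using assms by (induction p rule: poly_mapping_add_induct) (auto simp: free_proj_add)

lemma free_proj_scale:
  "free_proj \<nu> (Poly_Mapping.map ((*) c) p) = Poly_Mapping.map ((*) c) (free_proj \<nu> p)"
proof -
  have z: "Poly_Mapping.map ((*) c) 0 = (0 :: _ \<Rightarrow>\<^sub>0 qv)" by (rule poly_mapping_eqI) simp
  have "Poly_Mapping.keys p \<subseteq> UNIV" by simp
  then show ?thesis
    by (induction p rule: poly_mapping_add_induct) (auto simp: free_proj_add z)
qed

locale quantum_group =
  fixes D :: "('j, 'y::ab_group_add, 'x) datum"
begin

abbreviation "W \<equiv> lists (gens D)"
abbreviation "FA \<equiv> free_alg D"
abbreviation "U \<equiv> QG D"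
abbreviation cl where "cl \<equiv> QG_class D"

sublocale F: assoc_algebra FA
  unfolding free_alg_def by (rule assoc_algebra_monoid_algebra[OF monoid_free_monoid])

lemma free_alg_sel [simp]:
  "carrier FA = {p. Poly_Mapping.keys p \<subseteq> W}"
  "\<zero>\<^bsub>FA\<^esub> = 0"
  "\<one>\<^bsub>FA\<^esub> = word []"
  "p \<oplus>\<^bsub>FA\<^esub> q = p + q"
  "c \<odot>\<^bsub>FA\<^esub> p = Poly_Mapping.map ((*) c) p"
  "Poly_Mapping.single w a \<otimes>\<^bsub>FA\<^esub> Poly_Mapping.single w' b = Poly_Mapping.single (w @ w') (a * b)"
  by (simp_all add: free_alg_def free_monoid_def)

lemma gens_simps [simp]:
  "GE i \<in> gens D \<longleftrightarrow> i \<in> idx D" "GF i \<in> gens D \<longleftrightarrow> i \<in> idx D" "GK \<mu> \<in> gens D"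
  by (auto simp: gens_def)

text \<open>All defining relations are homogeneous.  In the commutator of \<open>E\<^sub>i\<close> and \<open>F\<^sub>j\<close> the right-hand side occurs only
for \<open>i = j\<close>, when both sides have degree zero; in a Serre relation every word contains the same letters.\<close>

lemma homogeneous_relations:
  assumes "s \<in> relations D"
  shows "\<exists>\<mu>. Poly_Mapping.keys s \<subseteq> W \<inter> {w. word_degree w = \<mu>}"
proof -
  have single: "Poly_Mapping.keys (Poly_Mapping.single w c :: _ \<Rightarrow>\<^sub>0 qv) \<subseteq> W \<inter> {w. word_degree w = \<mu>}"
    if "w \<in> W" "word_degree w = \<mu>" for w :: "('j, 'y) gen list" and c \<mu>
    using that by simp
  consider "s = word [GK 0] - word []"
    | \<mu> \<mu>' where "s = word [GK \<mu>, GK \<mu>'] - word [GK (\<mu> + \<mu>')]"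
    | \<mu> i c where "i \<in> idx D" "s = word [GK \<mu>, GE i] - Poly_Mapping.single [GE i, GK \<mu>] c"
    | \<mu> i c where "i \<in> idx D" "s = word [GK \<mu>, GF i] - Poly_Mapping.single [GF i, GK \<mu>] c"
    | i j where "i \<in> idx D" "j \<in> idx D" "s = word [GE i, GF j] - word [GF j, GE i] -
        (if i = j
         then Poly_Mapping.single [GK (scaled_coroot D i)] (1 / (vsub D i - inverse (vsub D i)))
            - Poly_Mapping.single [GK (- scaled_coroot D i)] (1 / (vsub D i - inverse (vsub D i)))
         else 0)"
    | x i j where "x \<in> {GE, GF}" "i \<in> idx D" "j \<in> idx D" "s = serre D x i j"
    using assms unfolding relations_def Un_iff mem_Collect_eq singleton_iff
    by (elim disjE exE conjE) metis+
  then show ?thesis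
  proof cases
    case 5
    then show ?thesis
      by (intro exI[of _ "frag_of i - frag_of j"])
        (simp, intro conjI impI keys_diff_subset single; simp)
  next
    case (6 x i j)
    define N where "N = nat (1 - pairing D (coroot D i) (simple_root D j))"
    have "word_degree (replicate (N - r) (x i) @ [x j] @ replicate r (x i)) =
        word_degree (replicate N (x i)) + gen_degree (x j)" if "r \<le> N" for r
    proof -
      have "replicate N (x i) = replicate (N - r) (x i) @ replicate r (x i)"
        using that by (simp add: replicate_add[symmetric])
      then show ?thesis by (simp add: algebra_simps)
    qed
    moreover have "replicate (N - r) (x i) @ [x j] @ replicate r (x i) \<in> W" for r
      using 6 by auto
    ultimately have "Poly_Mapping.keys s \<subseteq> W \<inter> {w. word_degree w = word_degree (replicate N (x i)) + gen_degree (x j)}"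
      unfolding 6(4) serre_def Let_def N_def[symmetric]
      by (intro order_trans[OF Poly_Mapping.keys_sum] UN_least single) auto
    then show ?thesis by blast
  next
    case 1 show ?thesis unfolding 1 by (intro exI[of _ 0] keys_diff_subset single) auto
  next
    case 2 show ?thesis unfolding 2 by (intro exI[of _ 0] keys_diff_subset single) auto
  next
    case (3 \<mu> i c)
    then show ?thesis unfolding 3 by (intro exI[of _ "frag_of i"] keys_diff_subset single) auto
  next
    case (4 \<mu> i c)
    then show ?thesis unfolding 4 by (intro exI[of _ "- frag_of i"] keys_diff_subset single) auto
  qed
qed

lemma relations_carrier: "relations D \<subseteq> carrier FA"
  using homogeneous_relations by fastforce

sublocale I: algebra_ideal FA "rel_ideal D"
  unfolding rel_ideal_def
  by (intro algebra_ideal.intro F.assoc_algebra_axioms F.genideal_ideal relations_carrier)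

sublocale U: assoc_algebra U
  unfolding QG_def by (rule I.assoc_algebra_quot)

lemma carrier_QG: "carrier U = cl ` {p. Poly_Mapping.keys p \<subseteq> W}"
  unfolding QG_def I.carrier_quot by (simp add: QG_class_def[abs_def])

lemma class_closed: "Poly_Mapping.keys p \<subseteq> W \<Longrightarrow> cl p \<in> carrier U"
  by (simp add: carrier_QG)

lemma class_add: "Poly_Mapping.keys p \<subseteq> W \<Longrightarrow> Poly_Mapping.keys q \<subseteq> W \<Longrightarrow> cl (p + q) = cl p \<oplus>\<^bsub>U\<^esub> cl q"
  using I.class_add[of p q] by (simp add: QG_class_def QG_def)

lemma class_mult: "Poly_Mapping.keys p \<subseteq> W \<Longrightarrow> Poly_Mapping.keys q \<subseteq> W \<Longrightarrow> cl (p \<otimes>\<^bsub>FA\<^esub> q) = cl p \<otimes>\<^bsub>U\<^esub> cl q"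
  using I.class_mult[of p q] by (simp add: QG_class_def QG_def)

lemma class_scale: "Poly_Mapping.keys p \<subseteq> W \<Longrightarrow> cl (Poly_Mapping.map ((*) c) p) = c \<odot>\<^bsub>U\<^esub> cl p"
  using I.class_smult[of p c] by (simp add: QG_class_def QG_def)

lemma class_one: "cl (word []) = \<one>\<^bsub>U\<^esub>"
  using I.class_one by (simp add: QG_class_def QG_def)

lemma class_zero_iff: "Poly_Mapping.keys p \<subseteq> W \<Longrightarrow> cl p = \<zero>\<^bsub>U\<^esub> \<longleftrightarrow> p \<in> rel_ideal D"
  using I.class_zero_iff[of p] by (simp add: QG_class_def QG_def)

lemma class_zero [simp]: "cl 0 = \<zero>\<^bsub>U\<^esub>"
  using class_zero_iff[of 0] I.zero_closed by simp

lemma class_diff: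
  assumes "Poly_Mapping.keys p \<subseteq> W" "Poly_Mapping.keys q \<subseteq> W"
  shows "cl (p - q) = cl p \<ominus>\<^bsub>U\<^esub> cl q"
proof -
  have "cl (p - q) \<oplus>\<^bsub>U\<^esub> cl q = cl p"
    using assms class_add[of "p - q" q] by (simp add: keys_diff_subset)
  then show ?thesis
    using class_closed[OF assms(1)] class_closed[OF assms(2)] class_closed[OF keys_diff_subset[OF assms]]
    by (metis U.add.inv_solve_right U.minus_eq)
qed

lemma class_eqI:
  assumes "p - q \<in> relations D" "Poly_Mapping.keys p \<subseteq> W" "Poly_Mapping.keys q \<subseteq> W"
  shows "cl p = cl q"
proof -
  have "p - q \<in> rel_ideal D"
    using assms(1) F.genideal_self[OF relations_carrier] by (auto simp: rel_ideal_def)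
  then have "cl p \<ominus>\<^bsub>U\<^esub> cl q = \<zero>\<^bsub>U\<^esub>"
    using assms class_zero_iff[of "p - q"] by (simp add: class_diff keys_diff_subset)
  then show ?thesis using assms by (simp add: U.minus_eq_zero_iff class_closed)
qed

abbreviation E where "E \<equiv> Egen D"
abbreviation F where "F \<equiv> Fgen D"
abbreviation K where "K \<equiv> Kgen D"

lemma generator_closed [simp, intro]:
  "i \<in> idx D \<Longrightarrow> E i \<in> carrier U" "i \<in> idx D \<Longrightarrow> F i \<in> carrier U" "K \<mu> \<in> carrier U"
  by (simp_all add: Egen_def Fgen_def Kgen_def class_closed)

lemma class_pair:
  assumes "g \<in> gens D" "h \<in> gens D"
  shows "cl (Poly_Mapping.single [g, h] c) = c \<odot>\<^bsub>U\<^esub> (cl (word [g]) \<otimes>\<^bsub>U\<^esub> cl (word [h]))"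
  using class_mult[of "word [g]" "word [h]"] class_scale[of "word [g, h]" c] assms by simp

lemma class_cons:
  assumes "g \<in> gens D" "w \<in> W"
  shows "cl (word (g # w)) = cl (word [g]) \<otimes>\<^bsub>U\<^esub> cl (word w)"
  using class_mult[of "word [g]" "word w"] assms by simp

lemma K_add: "K \<mu> \<otimes>\<^bsub>U\<^esub> K \<mu>' = K (\<mu> + \<mu>')"
proof -
  have "cl (word [GK \<mu>, GK \<mu>']) = K (\<mu> + \<mu>')"
    unfolding Kgen_def by (rule class_eqI) (auto simp: relations_def)
  then show ?thesis
    by (simp add: class_pair class_closed Kgen_def)
qed

lemma K_E: "i \<in> idx D \<Longrightarrow> K \<mu> \<otimes>\<^bsub>U\<^esub> E i = (vv powi pairing D \<mu> (simple_root D i)) \<odot>\<^bsub>U\<^esub> (E i \<otimes>\<^bsub>U\<^esub> K \<mu>)"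
proof -
  assume i: "i \<in> idx D"
  have "cl (word [GK \<mu>, GE i]) = cl (Poly_Mapping.single [GE i, GK \<mu>] (vv powi pairing D \<mu> (simple_root D i)))"
    by (rule class_eqI) (use i in \<open>auto simp: relations_def\<close>)
  then show ?thesis using i
    by (simp add: class_pair class_closed Kgen_def Egen_def)
qed

lemma K_F: "i \<in> idx D \<Longrightarrow> K \<mu> \<otimes>\<^bsub>U\<^esub> F i = (vv powi (- pairing D \<mu> (simple_root D i))) \<odot>\<^bsub>U\<^esub> (F i \<otimes>\<^bsub>U\<^esub> K \<mu>)"
proof -
  assume i: "i \<in> idx D"
  have "cl (word [GK \<mu>, GF i]) = cl (Poly_Mapping.single [GF i, GK \<mu>] (vv powi (- pairing D \<mu> (simple_root D i))))"
    by (rule class_eqI) (use i in \<open>auto simp: relations_def\<close>)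
  then show ?thesis using i
    by (simp add: class_pair class_closed Kgen_def Fgen_def)
qed

lemma word_induct [consumes 1, case_names one gen]:
  assumes "w \<in> W"
    and "P [] \<one>\<^bsub>U\<^esub>"
    and "\<And>g w. g \<in> gens D \<Longrightarrow> w \<in> W \<Longrightarrow> P w (cl (word w)) \<Longrightarrow> P (g # w) (cl (word [g]) \<otimes>\<^bsub>U\<^esub> cl (word w))"
  shows "P w (cl (word w))"
  using assms(1)
proof (induction w)
  case Nil
  then show ?case by (simp add: class_one assms(2))
next
  case (Cons g w)
  then show ?case by (subst class_cons) (simp_all add: assms(3))
qed

text \<open>The zero element is covered as a multiple of the empty word by the scalar zero.\<close>

lemma QG_word_induct [consumes 1, case_names word add]:
  assumes "x \<in> carrier U"
    and word: "\<And>w c. w \<in> W \<Longrightarrow> P (c \<odot>\<^bsub>U\<^esub> cl (word w))"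
    and add: "\<And>x y. x \<in> carrier U \<Longrightarrow> y \<in> carrier U \<Longrightarrow> P x \<Longrightarrow> P y \<Longrightarrow> P (x \<oplus>\<^bsub>U\<^esub> y)"
  shows "P x"
proof -
  obtain p where p: "Poly_Mapping.keys p \<subseteq> W" and x: "x = cl p"
    using assms(1) by (auto simp: carrier_QG)
  have "P (cl p)"
    using p
  proof (induction p rule: poly_mapping_add_induct)
    case zero
    show ?case using word[of "[]" 0] by (simp add: class_one)
  next
    case (single w c)
    then show ?case using word[of w c] class_scale[of "word w" c] by simp
  next
    case (add p q)
    then show ?case by (simp add: class_add class_closed assms(3))
  qed
  then show ?thesis by (simp add: x)
qed

lemma QG_deg_altdef: "QG_deg D \<nu> = cl ` {p. Poly_Mapping.keys p \<subseteq> W \<inter> {w. word_degree w = \<nu>}}"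
  by (auto simp: QG_deg_def word_degree_def)

text \<open>Since the relations are homogeneous, so are their products with words.  The projection to degree \<open>\<nu>\<close> either
fixes such a product or kills it, hence preserves the ideal they span.\<close>

lemma free_proj_ideal:
  assumes "p \<in> rel_ideal D"
  shows "free_proj \<nu> p \<in> rel_ideal D"
proof -
  have "rel_ideal D \<subseteq> {p. Poly_Mapping.keys p \<subseteq> W \<and> free_proj \<nu> p \<in> rel_ideal D}"
    unfolding rel_ideal_def free_alg_def
  proof (rule genideal_monoid_algebra_subset[OF monoid_free_monoid], goal_cases)
    case 1
    then show ?case using relations_carrier by (simp add: free_alg_def)
  next
    case 2
    then show ?case using I.zero_closed by (simp add: free_alg_def rel_ideal_def)
  next
    case (3 p q)
    then show ?case using I.a_closed[of "free_proj \<nu> p" "free_proj \<nu> q"]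
      by (simp add: free_alg_def rel_ideal_def free_proj_add keys_add_subset)
  next
    case (4 m n c s)
    have mn: "m \<in> W" "n \<in> W" using 4 by (auto simp: free_monoid_def)
    obtain \<mu> where s: "Poly_Mapping.keys s \<subseteq> W \<inter> {w. word_degree w = \<mu>}"
      using homogeneous_relations 4 by blast
    define t where "t = Poly_Mapping.single m c \<otimes>\<^bsub>FA\<^esub> s \<otimes>\<^bsub>FA\<^esub> word n"
    have "Poly_Mapping.keys t \<subseteq> W \<inter> {w. word_degree w = word_degree m + \<mu> + word_degree n}"
      unfolding t_def using s
    proof (induction s rule: poly_mapping_add_induct)
      case (add p q)
      then show ?case
        by (simp add: free_alg_def monoid_algebra_mult_add_left monoid_algebra_mult_add_right keys_add_subset)
    next
      case zero then show ?case by (simp add: free_alg_def)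
    qed (use mn in auto)
    moreover have "s \<in> rel_ideal D"
      using 4 F.genideal_self[OF relations_carrier] by (auto simp: rel_ideal_def)
    then have "t \<in> rel_ideal D"
      unfolding t_def using mn by (intro I.I_r_closed I.I_l_closed) auto
    ultimately have "Poly_Mapping.keys t \<subseteq> W \<and> free_proj \<nu> t \<in> rel_ideal D"
      using free_proj_homogeneous[of t "word_degree m + \<mu> + word_degree n" \<nu>] I.zero_closed by auto
    then show ?case by (simp add: t_def free_alg_def rel_ideal_def)
  qed
  with assms show ?thesis by blast
qed

text \<open>The representative is chosen arbitrarily: two of them differ by an element of the ideal, and \<open>free_proj\<close>
preserves the ideal.\<close>

definition deg_proj :: "('j \<Rightarrow>\<^sub>0 int) \<Rightarrow> ('j, 'y) qgrp \<Rightarrow> ('j, 'y) qgrp" where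
  "deg_proj \<nu> x = cl (free_proj \<nu> (SOME p. Poly_Mapping.keys p \<subseteq> W \<and> x = cl p))"

lemma keys_free_proj_W: "Poly_Mapping.keys p \<subseteq> W \<Longrightarrow> Poly_Mapping.keys (free_proj \<nu> p) \<subseteq> W"
  using keys_free_proj by blast

lemma deg_proj_class:
  assumes p: "Poly_Mapping.keys p \<subseteq> W"
  shows "deg_proj \<nu> (cl p) = cl (free_proj \<nu> p)"
proof -
  define q where "q = (SOME q. Poly_Mapping.keys q \<subseteq> W \<and> cl p = cl q)"
  have q: "Poly_Mapping.keys q \<subseteq> W \<and> cl p = cl q"
    unfolding q_def by (rule someI[of _ p]) (use p in simp)
  have diff: "free_proj \<nu> (q - p) = free_proj \<nu> q - free_proj \<nu> p"
    using free_proj_add[of \<nu> "q - p" p] by (simp add: eq_diff_eq)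
  have "cl (q - p) = \<zero>\<^bsub>U\<^esub>"
    using p q class_closed[OF p] by (simp add: class_diff U.minus_eq_zero_iff)
  then have "q - p \<in> rel_ideal D"
    using p q by (subst (asm) class_zero_iff) (simp_all add: keys_diff_subset)
  then have "cl (free_proj \<nu> (q - p)) = \<zero>\<^bsub>U\<^esub>"
    using free_proj_ideal[of "q - p" \<nu>] p q by (simp add: class_zero_iff keys_free_proj_W keys_diff_subset)
  then have "cl (free_proj \<nu> q) \<ominus>\<^bsub>U\<^esub> cl (free_proj \<nu> p) = \<zero>\<^bsub>U\<^esub>"
    using p q by (simp add: diff class_diff keys_free_proj_W)
  then have "cl (free_proj \<nu> q) = cl (free_proj \<nu> p)"
    using p q by (subst (asm) U.minus_eq_zero_iff) (auto intro!: class_closed keys_free_proj_W)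
  then show ?thesis by (simp add: deg_proj_def q_def[symmetric])
qed

lemma deg_proj_word:
  assumes "w \<in> W"
  shows "deg_proj \<nu> (cl (word w)) = (if word_degree w = \<nu> then cl (word w) else \<zero>\<^bsub>U\<^esub>)"
  using assms by (simp add: deg_proj_class)

lemma word_in_QG_deg: "w \<in> W \<Longrightarrow> cl (word w) \<in> QG_deg D (word_degree w)"
  unfolding QG_deg_altdef by (rule imageI) simp

sublocale G: graded_space U "QG_deg D" deg_proj
proof (unfold_locales, goal_cases)
  case (1 \<nu>)
  then show ?case by (auto simp: QG_deg_altdef carrier_QG)
next
  case (2 \<nu>)
  show ?case
    unfolding alg_linear_def carrier_QG
    by (auto simp: class_add[symmetric] class_scale[symmetric] deg_proj_class keys_add_subset
        keys_free_proj_W free_proj_add free_proj_scale order_trans[OF keys_map_scale])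
next
  case (3 x \<nu>)
  then obtain p where "Poly_Mapping.keys p \<subseteq> W" "x = cl p" by (auto simp: carrier_QG)
  then show ?case
    using keys_free_proj[of \<nu> p] unfolding QG_deg_altdef by (auto simp: deg_proj_class intro!: imageI)
next
  case (4 x \<nu>)
  then show ?case
    by (auto simp: QG_deg_altdef deg_proj_class free_proj_homogeneous)
next
  case (5 x \<nu> \<nu>')
  then show ?case
    by (auto simp: QG_deg_altdef deg_proj_class free_proj_homogeneous)
next
  case (6 x P)
  from 6(1) show ?case
  proof (induction x rule: QG_word_induct)
    case (word w c)
    have "cl (Poly_Mapping.map ((*) c) (word w)) \<in> QG_deg D (word_degree w)"
      using word unfolding QG_deg_altdef by (intro imageI) (simp split: if_splits)
    then show ?case using word class_scale[of "word w" c] 6(2) by simp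
  qed (rule 6(3))
qed

lemma QG_deg_smult: "x \<in> QG_deg D \<nu> \<Longrightarrow> c \<odot>\<^bsub>U\<^esub> x \<in> QG_deg D \<nu>"
  using G.proj_in_component[of "c \<odot>\<^bsub>U\<^esub> x" \<nu>] G.component_subset[of \<nu>]
  by (auto simp: G.proj_smult G.proj_same)

lemma QG_deg_add: "x \<in> QG_deg D \<nu> \<Longrightarrow> y \<in> QG_deg D \<nu> \<Longrightarrow> x \<oplus>\<^bsub>U\<^esub> y \<in> QG_deg D \<nu>"
  using G.proj_in_component[of "x \<oplus>\<^bsub>U\<^esub> y" \<nu>] G.component_subset[of \<nu>]
  by (auto simp: G.proj_add G.proj_same subset_iff)

lemma QG_deg_mult:
  assumes "x \<in> QG_deg D \<mu>" "y \<in> QG_deg D \<nu>"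
  shows "x \<otimes>\<^bsub>U\<^esub> y \<in> QG_deg D (\<mu> + \<nu>)"
proof -
  obtain p q where p: "Poly_Mapping.keys p \<subseteq> W \<inter> {w. word_degree w = \<mu>}" "x = cl p"
    and q: "Poly_Mapping.keys q \<subseteq> W \<inter> {w. word_degree w = \<nu>}" "y = cl q"
    using assms by (auto simp: QG_deg_altdef)
  have "Poly_Mapping.keys (p \<otimes>\<^bsub>FA\<^esub> q) \<subseteq> W \<inter> {w. word_degree w = \<mu> + \<nu>}"
    unfolding free_alg_def monoid_algebra_mult_linext
    by (intro keys_linext_subset[OF p(1)] keys_linext_subset[OF q(1)]) (auto simp: free_monoid_def)
  moreover have "x \<otimes>\<^bsub>U\<^esub> y = cl (p \<otimes>\<^bsub>FA\<^esub> q)"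
    using p q by (simp add: class_mult)
  ultimately show ?thesis by (simp add: QG_deg_altdef)
qed

lemma E_degree: "i \<in> idx D \<Longrightarrow> E i \<in> QG_deg D (frag_of i)"
  and F_degree: "i \<in> idx D \<Longrightarrow> F i \<in> QG_deg D (- frag_of i)"
  and K_degree: "K \<mu> \<in> QG_deg D 0"
  and one_degree: "\<one>\<^bsub>U\<^esub> \<in> QG_deg D 0"
  using word_in_QG_deg[of "[GE i]"] word_in_QG_deg[of "[GF i]"] word_in_QG_deg[of "[GK \<mu>]"]
    word_in_QG_deg[of "[]"]
  by (simp_all add: Egen_def Fgen_def Kgen_def class_one)

end

section \<open>Contracting an edge\<close>

locale edge_contraction =
  fixes D :: "('i, 'y::ab_group_add, 'x::ab_group_add) datum"
    and ip im :: 'i and \<epsilon> :: int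
  assumes root: "root_datum D" and edge: "contractible_edge D ip im" and eps: "\<epsilon> \<in> {1, -1}"
begin

abbreviation "C \<equiv> contraction D ip im"
abbreviation "i0 \<equiv> izero ip im"
abbreviation "half \<equiv> dot D ip ip div 2"

lemma ends [simp]: "ip \<in> idx D" "im \<in> idx D"
  using edge by (auto simp: contractible_edge_def)

lemma form_add: "x \<in> int_span (idx D) \<Longrightarrow> y \<in> int_span (idx D) \<Longrightarrow> z \<in> int_span (idx D) \<Longrightarrow>
    form D (x + y) z = form D x z + form D y z"
  and form_sym: "x \<in> int_span (idx D) \<Longrightarrow> y \<in> int_span (idx D) \<Longrightarrow> form D x y = form D y x"
  using root unfolding root_datum_def cartan_datum_def by blast+

lemma dot_pos: "i \<in> idx D \<Longrightarrow> dot D i i > 0" and dot_even: "i \<in> idx D \<Longrightarrow> even (dot D i i)"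
  using root unfolding root_datum_def cartan_datum_def dot_def by blast+

lemma dot_sym: "i \<in> idx D \<Longrightarrow> j \<in> idx D \<Longrightarrow> dot D i j = dot D j i"
  unfolding dot_def by (rule form_sym) auto

lemma half_pos: "half > 0" and dot_ends: "dot D ip ip = 2 * half" "dot D im im = 2 * half"
  "dot D ip im = - half" "dot D im ip = - half"
  using dot_pos[of ip] dot_even[of ip] dot_sym[of im ip] edge
  by (auto simp: contractible_edge_def elim!: evenE)

lemma ends_distinct [simp]: "ip \<noteq> im" "im \<noteq> ip"
  using dot_ends half_pos by auto

lemma pairing_add: "pairing D (\<mu> + \<mu>') x = pairing D \<mu> x + pairing D \<mu>' x"
  and pairing_minus: "pairing D (- \<mu>) x = - pairing D \<mu> x"
  and pairing_zero: "pairing D 0 x = 0"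
proof -
  have *: "additive (\<lambda>y. pairing D y x)" for x
    using root by (auto simp: root_datum_def perfect_pairing_def)
  show "pairing D (\<mu> + \<mu>') x = pairing D \<mu> x + pairing D \<mu>' x"
    "pairing D (- \<mu>) x = - pairing D \<mu> x" "pairing D 0 x = 0"
    using additive.add[OF *] additive.minus[OF *] additive.zero[OF *] by blast+
qed

lemma pairing_sum_const: "pairing D (\<Sum>k<n. \<mu>) x = int n * pairing D \<mu> x"
  by (induction n) (simp_all add: pairing_add pairing_zero algebra_simps)

text \<open>The condition on the edge says that both of its Cartan integers are \<open>-1\<close>.  Hence \<open>K\<close> at one end commutes past
\<open>E\<close> at the other up to \<open>vv powi (- half)\<close>, which is the inverse of the \<open>v\<close> of the new vertex.\<close>

lemma pairing_scaled_ends: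
  "pairing D (scaled_coroot D im) (simple_root D ip) = - half"
  "pairing D (scaled_coroot D ip) (simple_root D im) = - half"
proof -
  have "of_int (pairing D (coroot D i) (simple_root D j)) = (2 * of_int (dot D i j) / of_int (dot D i i) :: rat)"
    if "i \<in> idx D" "j \<in> idx D" for i j
    using root that by (simp add: root_datum_def)
  from this[of im ip] this[of ip im]
  have "of_int (pairing D (coroot D im) (simple_root D ip)) = (-1::rat)"
    "of_int (pairing D (coroot D ip) (simple_root D im)) = (-1::rat)"
    using half_pos dot_ends by simp_all
  then have "pairing D (coroot D im) (simple_root D ip) = -1" "pairing D (coroot D ip) (simple_root D im) = -1"
    by (metis of_int_1 of_int_eq_iff of_int_minus)+
  then show "pairing D (scaled_coroot D im) (simple_root D ip) = - half"
    "pairing D (scaled_coroot D ip) (simple_root D im) = - half"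
    using half_pos dot_ends by (simp_all add: scaled_coroot_def pairing_sum_const)
qed

lemma lat_incl_simps [simp]:
  "lat_incl 0 = 0" "lat_incl (frag_of a) = a" "lat_incl (x + y) = lat_incl x + lat_incl y"
  "lat_incl (- x) = - lat_incl x"
  by (simp_all add: lat_incl_def frag_extend_add frag_extend_minus)

lemma idx_C: "idx C = frag_of ` (idx D - {ip, im}) \<union> {i0}"
  by (simp add: contraction_def)

lemma frag_of_noteq_i0 [simp]: "frag_of i \<noteq> i0"
proof
  assume "frag_of i = i0"
  then have "Poly_Mapping.lookup (frag_of i) j = Poly_Mapping.lookup i0 j" for j by simp
  from this[of ip] this[of im] ends_distinct(1) show False
    by (auto simp: izero_def lookup_add simp del: ends_distinct split: if_splits)
qed

lemma inv_frag_of [simp]: "inv_into UNIV frag_of (frag_of i) = i"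
  by (rule inv_into_f_f) (auto simp: inj_def frag_of_eq)

text \<open>The new vertex has the same length as the two contracted ones: with \<open>a = i\<^sub>+ \<cdot> i\<^sub>+\<close> its square is
\<open>a + a + 2 (- a / 2) = a\<close>.\<close>

lemma dot_C: "dot C (frag_of i) (frag_of i) = dot D i i" "dot C i0 i0 = 2 * half"
proof -
  show "dot C (frag_of i) (frag_of i) = dot D i i"
    by (simp add: dot_def contraction_def)
  have "i0 \<in> int_span (idx D)" 
    by (simp add: izero_def keys_add_subset)
  then have "form D i0 i0 = dot D ip ip + dot D ip im + dot D im ip + dot D im im"
    using form_add[of "frag_of ip" "frag_of im" "frag_of ip + frag_of im"]
      form_sym[of "frag_of ip" "frag_of ip + frag_of im"] form_sym[of "frag_of im" "frag_of ip + frag_of im"]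
      form_add[of "frag_of ip" "frag_of im" "frag_of ip"] form_add[of "frag_of ip" "frag_of im" "frag_of im"]
    by (simp add: izero_def dot_def)
  then show "dot C i0 i0 = 2 * half"
    using dot_ends by (simp add: dot_def contraction_def)
qed

text \<open>By the equality of lengths, \<open>K\<close> at the new vertex is the product of the two old ones.\<close>

lemma scaled_coroot_C:
  "scaled_coroot C (frag_of i) = scaled_coroot D i"
  "scaled_coroot C i0 = scaled_coroot D ip + scaled_coroot D im"
  using dot_ends
  by (simp_all add: scaled_coroot_def dot_C sum.distrib) (simp_all add: contraction_def sum.distrib)

lemma vsub_C: "vsub C i0 = vv powi half"
  by (simp add: vsub_def dot_C)

text \<open>A degree in \<open>\<int>[I]\<close> lies in the lattice of the contracted datum exactly when its imbalance vanishes.\<close>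

definition imbalance :: "('i \<Rightarrow>\<^sub>0 int) \<Rightarrow> int" where
  "imbalance \<alpha> = Poly_Mapping.lookup \<alpha> ip - Poly_Mapping.lookup \<alpha> im"

lemma imbalance_add: "imbalance (\<alpha> + \<beta>) = imbalance \<alpha> + imbalance \<beta>"
  by (simp add: imbalance_def lookup_add)

lemma lookup_lat_incl:
  assumes "x \<in> int_span (idx C)"
  shows "i \<notin> {ip, im} \<Longrightarrow> Poly_Mapping.lookup (lat_incl x) i = Poly_Mapping.lookup x (frag_of i)"
    and "i \<in> {ip, im} \<Longrightarrow> Poly_Mapping.lookup (lat_incl x) i = Poly_Mapping.lookup x i0"
proof -
  have "Poly_Mapping.keys x \<subseteq> idx C" using assms by simp
  then have "(i \<notin> {ip, im} \<longrightarrow> Poly_Mapping.lookup (lat_incl x) i = Poly_Mapping.lookup x (frag_of i)) \<and>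
    (i \<in> {ip, im} \<longrightarrow> Poly_Mapping.lookup (lat_incl x) i = Poly_Mapping.lookup x i0)"
  proof (induction x rule: frag_induction)
    case (one a)
    then consider j where "j \<noteq> ip" "j \<noteq> im" "a = frag_of j" | "a = i0" by (auto simp: idx_C)
    then show ?case
    proof cases
      case 1
      then show ?thesis by (auto simp: frag_of_eq frag_of_noteq_i0[symmetric])
    next
      case 2
      then show ?thesis by (auto simp: frag_of_noteq_i0[symmetric] lookup_add) (auto simp: izero_def lookup_add)
    qed
  next
    case (diff a b)
    then show ?case by (auto simp: lat_incl_def frag_extend_diff lookup_minus)
  qed simp
  then show "i \<notin> {ip, im} \<Longrightarrow> Poly_Mapping.lookup (lat_incl x) i = Poly_Mapping.lookup x (frag_of i)"
    and "i \<in> {ip, im} \<Longrightarrow> Poly_Mapping.lookup (lat_incl x) i = Poly_Mapping.lookup x i0" by blast+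
qed

lemma imbalance_lat_incl: "x \<in> int_span (idx C) \<Longrightarrow> imbalance (lat_incl x) = 0"
  by (simp add: imbalance_def lookup_lat_incl)

text \<open>The inclusion of the small lattice can be inverted: the coefficient at the new vertex is read off at
\<open>ip\<close>.  So components of different degrees stay different after the embedding.\<close>

lemma lat_incl_inj: "inj_on lat_incl (int_span (idx C))"
proof (rule inj_onI)
  fix x y assume x: "x \<in> int_span (idx C)" and y: "y \<in> int_span (idx C)" and eq: "lat_incl x = lat_incl y"
  show "x = y"
  proof (rule poly_mapping_eqI)
    fix a
    consider j where "j \<notin> {ip, im}" "a = frag_of j" | "a = i0" | "a \<notin> idx C" by (auto simp: idx_C)
    then show "Poly_Mapping.lookup x a = Poly_Mapping.lookup y a"
    proof cases
      case (1 j)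
      then show ?thesis using lookup_lat_incl(1)[OF x, of j] lookup_lat_incl(1)[OF y, of j] eq by simp
    next
      case 2
      then show ?thesis using lookup_lat_incl(2)[OF x, of ip] lookup_lat_incl(2)[OF y, of ip] eq by simp
    next
      case 3
      then have "a \<notin> Poly_Mapping.keys x" "a \<notin> Poly_Mapping.keys y" using x y by auto
      then show ?thesis by (simp add: in_keys_iff)
    qed
  qed
qed

end

section \<open>The coproduct of a twisted commutator\<close>

text \<open>Read \<open>e\<close>, \<open>f\<close> as \<open>E\<^sub>+\<close>, \<open>E\<^sub>-\<close> and \<open>k\<close>, \<open>l\<close> as the corresponding \<open>K\<close>.  Expanding the twisted commutator of the two
coproducts gives the coproduct that a generator \<open>x = e f - q f e\<close> with \<open>K\<close>-part \<open>k l\<close> should have, plus cross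
terms with one of \<open>e\<close>, \<open>f\<close> in each tensor factor.  The commutation rules with constant \<open>s\<close> collect the cross
terms into two, with coefficients \<open>1 - q s\<close> and \<open>s - q\<close>; one of them vanishes if \<open>q\<close> is \<open>s\<close> or its inverse.\<close>

lemma (in assoc_algebra) tensor_commutator_left:
  fixes q s :: 'k
  defines "T \<equiv> tensor_algebra A A"
  assumes c: "e \<in> carrier A" "f \<in> carrier A" "k \<in> carrier A" "l \<in> carrier A"
    and kl: "l \<otimes> k = k \<otimes> l" and kf: "k \<otimes> f = s \<odot> (f \<otimes> k)" and le: "l \<otimes> e = s \<odot> (e \<otimes> l)"
    and r: "r = - q"
  defines "x \<equiv> e \<otimes> f \<oplus> r \<odot> (f \<otimes> e)"
    and "\<Delta>e \<equiv> tensor A A e \<one> \<oplus>\<^bsub>T\<^esub> tensor A A k e"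
    and "\<Delta>f \<equiv> tensor A A f \<one> \<oplus>\<^bsub>T\<^esub> tensor A A l f"
  shows "\<Delta>e \<otimes>\<^bsub>T\<^esub> \<Delta>f \<oplus>\<^bsub>T\<^esub> r \<odot>\<^bsub>T\<^esub> (\<Delta>f \<otimes>\<^bsub>T\<^esub> \<Delta>e) =
    (tensor A A x \<one> \<oplus>\<^bsub>T\<^esub> tensor A A (k \<otimes> l) x) \<oplus>\<^bsub>T\<^esub>
    ((1 - q * s) \<odot>\<^bsub>T\<^esub> tensor A A (e \<otimes> l) f \<oplus>\<^bsub>T\<^esub> (s - q) \<odot>\<^bsub>T\<^esub> tensor A A (f \<otimes> k) e)"
proof -
  interpret P: tensor_pair A A by unfold_locales
  note d = P.T.l_distr P.T.r_distr P.T.smult_r_distr P.tensor_mult P.tensor_add_left P.tensor_add_right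
    P.tensor_smult_left P.tensor_smult_right
  show ?thesis
    unfolding T_def x_def \<Delta>e_def \<Delta>f_def using c
    by (simp add: d kl kf le r P.T.smult_diff P.T.smult_smult[symmetric] P.T.a_ac)
qed

text \<open>The same for \<open>F\<close>, whose coproduct has the inverse \<open>K\<close> in the second factor.  Here \<open>e\<close>, \<open>f\<close> are \<open>F\<^sub>-\<close>, \<open>F\<^sub>+\<close>.\<close>

lemma (in assoc_algebra) tensor_commutator_right:
  fixes q s :: 'k
  defines "T \<equiv> tensor_algebra A A"
  assumes c: "e \<in> carrier A" "f \<in> carrier A" "k \<in> carrier A" "l \<in> carrier A"
    and kl: "l \<otimes> k = k \<otimes> l" and kf: "k \<otimes> f = s \<odot> (f \<otimes> k)" and le: "l \<otimes> e = s \<odot> (e \<otimes> l)"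
    and r: "r = - q"
  defines "x \<equiv> e \<otimes> f \<oplus> r \<odot> (f \<otimes> e)"
    and "\<Delta>e \<equiv> tensor A A e k \<oplus>\<^bsub>T\<^esub> tensor A A \<one> e"
    and "\<Delta>f \<equiv> tensor A A f l \<oplus>\<^bsub>T\<^esub> tensor A A \<one> f"
  shows "\<Delta>e \<otimes>\<^bsub>T\<^esub> \<Delta>f \<oplus>\<^bsub>T\<^esub> r \<odot>\<^bsub>T\<^esub> (\<Delta>f \<otimes>\<^bsub>T\<^esub> \<Delta>e) =
    (tensor A A x (k \<otimes> l) \<oplus>\<^bsub>T\<^esub> tensor A A \<one> x) \<oplus>\<^bsub>T\<^esub>
    ((1 - q * s) \<odot>\<^bsub>T\<^esub> tensor A A f (e \<otimes> l) \<oplus>\<^bsub>T\<^esub> (s - q) \<odot>\<^bsub>T\<^esub> tensor A A e (f \<otimes> k))"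
proof -
  interpret P: tensor_pair A A by unfold_locales
  note d = P.T.l_distr P.T.r_distr P.T.smult_r_distr P.tensor_mult P.tensor_add_left P.tensor_add_right
    P.tensor_smult_left P.tensor_smult_right
  show ?thesis
    unfolding T_def x_def \<Delta>e_def \<Delta>f_def using c
    by (simp add: d kl kf le r P.T.smult_diff P.T.smult_smult[symmetric] P.T.a_ac)
qed

section \<open>Comparing the two coproducts\<close>

lemma vv_nonzero [simp]: "vv \<noteq> 0"
  by (simp add: vv_def eq_fract Zero_fract_def)

locale contraction_hom = edge_contraction D ip im \<epsilon>
  for D :: "('i, 'y::ab_group_add, 'x::ab_group_add) datum"
    and ip im :: 'i and \<epsilon> :: int +
  fixes \<Delta>I :: "('i, 'y) qgrp \<Rightarrow> (('i, 'y) qgrp \<times> ('i, 'y) qgrp \<Rightarrow>\<^sub>0 qv) set"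
    and \<Delta>C :: "('i \<Rightarrow>\<^sub>0 int, 'y) qgrp \<Rightarrow>
                   (('i \<Rightarrow>\<^sub>0 int, 'y) qgrp \<times> ('i \<Rightarrow>\<^sub>0 int, 'y) qgrp \<Rightarrow>\<^sub>0 qv) set"
    and \<Psi> :: "('i \<Rightarrow>\<^sub>0 int, 'y) qgrp \<Rightarrow> ('i, 'y) qgrp"
  assumes comult_I: "is_comult D \<Delta>I"
    and comult_C: "is_comult (contraction D ip im) \<Delta>C"
    and hom_Psi: "is_contraction_hom D ip im \<epsilon> \<Psi>"
begin

sublocale I: quantum_group D .
sublocale Q: quantum_group C .

sublocale TI: tensor_graded "QG D" "QG_deg D" I.deg_proj "QG D" "QG_deg D" I.deg_proj ..
sublocale TQ: tensor_graded "QG C" "QG_deg C" Q.deg_proj "QG C" "QG_deg C" Q.deg_proj ..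

lemma Psi_hom: "\<Psi> \<in> alg_hom (QG C) (QG D)"
  using hom_Psi by (simp add: is_contraction_hom_def Let_def)

lemmas Psi = alg_homD[OF Psi_hom]

lemma comult_hom: "\<Delta>I \<in> alg_hom (QG D) TI.T" "\<Delta>C \<in> alg_hom (QG C) TQ.T"
  using comult_I comult_C by (simp_all add: is_comult_def Let_def)

lemmas DeltaI = alg_homD[OF comult_hom(1)]
lemmas DeltaC = alg_homD[OF comult_hom(2)]

sublocale PP: tensor_functor "QG C" "QG C" "QG D" "QG D" \<Psi> \<Psi>
  by (intro tensor_functor.intro TI.tensor_pair_axioms TQ.tensor_pair_axioms tensor_functor_axioms.intro
      alg_hom_linear Psi_hom)

text \<open>The first two are minus the scalars in the images of the new \<open>E\<close> and \<open>F\<close>.  The third is the constant by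
which \<open>K\<close> at one contracted vertex commutes past \<open>E\<close> at the other, and inverse \<open>K\<close> past \<open>F\<close>.\<close>

abbreviation "coeffE \<equiv> - (vv powi (- (\<epsilon> * half)))"
abbreviation "coeffF \<equiv> - (vv powi (\<epsilon> * half))"
abbreviation "twist \<equiv> vv powi (- half)"

lemma generator_images:
  "i \<in> idx D - {ip, im} \<Longrightarrow> \<Psi> (Q.E (frag_of i)) = I.E i"
  "i \<in> idx D - {ip, im} \<Longrightarrow> \<Psi> (Q.F (frag_of i)) = I.F i"
  "\<Psi> (Q.K \<mu>) = I.K \<mu>"
  using hom_Psi by (simp_all add: is_contraction_hom_def Let_def)

lemma Psi_E0: "\<Psi> (Q.E i0) = I.E ip \<otimes>\<^bsub>QG D\<^esub> I.E im \<oplus>\<^bsub>QG D\<^esub> coeffE \<odot>\<^bsub>QG D\<^esub> (I.E im \<otimes>\<^bsub>QG D\<^esub> I.E ip)"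
  and Psi_F0: "\<Psi> (Q.F i0) = I.F im \<otimes>\<^bsub>QG D\<^esub> I.F ip \<oplus>\<^bsub>QG D\<^esub> coeffF \<odot>\<^bsub>QG D\<^esub> (I.F ip \<otimes>\<^bsub>QG D\<^esub> I.F im)"
proof -
  have *: "\<ominus>\<^bsub>QG D\<^esub> (c \<odot>\<^bsub>QG D\<^esub> x) = (- c) \<odot>\<^bsub>QG D\<^esub> x" if "x \<in> carrier (QG D)" for c x
    using that I.U.smult_minus_one[of "c \<odot>\<^bsub>QG D\<^esub> x"] I.U.smult_smult[of x "-1" c] by simp
  show "\<Psi> (Q.E i0) = I.E ip \<otimes>\<^bsub>QG D\<^esub> I.E im \<oplus>\<^bsub>QG D\<^esub> coeffE \<odot>\<^bsub>QG D\<^esub> (I.E im \<otimes>\<^bsub>QG D\<^esub> I.E ip)"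
   "\<Psi> (Q.F i0) = I.F im \<otimes>\<^bsub>QG D\<^esub> I.F ip \<oplus>\<^bsub>QG D\<^esub> coeffF \<odot>\<^bsub>QG D\<^esub> (I.F ip \<otimes>\<^bsub>QG D\<^esub> I.F im)"
    using hom_Psi by (simp_all add: is_contraction_hom_def Let_def vsub_C a_minus_def * 
        power_int_mult[symmetric] mult.commute)
qed

lemma Psi_gen_degree:
  assumes "g \<in> gens C"
  shows "\<Psi> (Q.cl (word [g])) \<in> QG_deg D (lat_incl (gen_degree g))"
proof -
  have deg2: "x \<otimes>\<^bsub>QG D\<^esub> y \<oplus>\<^bsub>QG D\<^esub> c \<odot>\<^bsub>QG D\<^esub> (y \<otimes>\<^bsub>QG D\<^esub> x) \<in> QG_deg D (\<alpha> + \<beta>)"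
    if "x \<in> QG_deg D \<alpha>" "y \<in> QG_deg D \<beta>" for x y c \<alpha> \<beta>
    using that I.QG_deg_mult[of x \<alpha> y \<beta>] I.QG_deg_mult[of y \<beta> x \<alpha>]
    by (intro I.QG_deg_add I.QG_deg_smult) (simp_all add: add.commute)
  have E0: "\<Psi> (Q.E i0) \<in> QG_deg D i0"
    using deg2[OF I.E_degree[of ip] I.E_degree[of im], of coeffE]
    unfolding Psi_E0 by (simp add: izero_def)
  have "- i0 = - frag_of im + - frag_of ip" by (simp add: izero_def)
  then have F0: "\<Psi> (Q.F i0) \<in> QG_deg D (- i0)"
    using deg2[OF I.F_degree[of im] I.F_degree[of ip], of coeffF] unfolding Psi_F0 by simp
  consider i where "i \<in> idx D - {ip, im}" "g = GE (frag_of i)" | "g = GE i0"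
    | i where "i \<in> idx D - {ip, im}" "g = GF (frag_of i)" | "g = GF i0" | \<mu> where "g = GK \<mu>"
    using assms by (auto simp: gens_def idx_C)
  then show ?thesis
    by cases
      (use E0 F0 in \<open>simp_all add: Egen_def[symmetric] Fgen_def[symmetric] Kgen_def[symmetric]
        generator_images I.E_degree I.F_degree I.K_degree\<close>)
qed

lemma Psi_word_degree:
  assumes "w \<in> Q.W"
  shows "\<Psi> (Q.cl (word w)) \<in> QG_deg D (lat_incl (word_degree w))"
  using assms
proof (induction rule: Q.word_induct)
  case one
  then show ?case by (simp add: Psi I.one_degree)
next
  case (gen g w)
  then have "Q.cl (word [g]) \<in> carrier (QG C)" "Q.cl (word w) \<in> carrier (QG C)"
    by (auto intro!: Q.class_closed)
  then show ?case
    using gen I.QG_deg_mult[OF Psi_gen_degree[of g]] by (simp add: Psi)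
qed

lemma word_degree_span: "w \<in> Q.W \<Longrightarrow> word_degree w \<in> int_span (idx C)"
proof (induction w)
  case (Cons g w)
  then have "gen_degree g \<in> int_span (idx C)"
    by (cases g) (auto simp: gens_def)
  then show ?case using Cons by (simp add: keys_add_subset)
qed simp

text \<open>Distinct degrees have distinct images in \<open>\<int>[I]\<close>, so the projection to the image of \<open>\<alpha>\<close> catches nothing but
the image of degree \<open>\<alpha>\<close>.\<close>

lemma Psi_deg_proj:
  assumes "x \<in> carrier (QG C)" and \<alpha>: "\<alpha> \<in> int_span (idx C)"
  shows "\<Psi> (Q.deg_proj \<alpha> x) = I.deg_proj (lat_incl \<alpha>) (\<Psi> x)"
  using assms(1)
proof (induction x rule: Q.QG_word_induct)
  case (word w c)
  have cw: "Q.cl (word w) \<in> carrier (QG C)" using word by (auto intro: Q.class_closed)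
  have P0: "\<Psi> \<zero>\<^bsub>QG C\<^esub> = \<zero>\<^bsub>QG D\<^esub>"
    using Psi(5)[of "\<zero>\<^bsub>QG C\<^esub>" 0] Psi(1)[of "\<zero>\<^bsub>QG C\<^esub>"] by simp
  have "\<Psi> (Q.deg_proj \<alpha> (Q.cl (word w))) = I.deg_proj (lat_incl \<alpha>) (\<Psi> (Q.cl (word w)))"
  proof (cases "word_degree w = \<alpha>")
    case True
    then show ?thesis using word Psi_word_degree[OF word] by (simp add: Q.deg_proj_word I.G.proj_same)
  next
    case False
    then have "lat_incl \<alpha> \<noteq> lat_incl (word_degree w)"
      using lat_incl_inj \<alpha> word_degree_span[OF word] by (auto dest: inj_onD)
    then show ?thesis using False word Psi_word_degree[OF word]
      by (simp add: Q.deg_proj_word I.G.proj_other P0)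
  qed
  then show ?case using cw by (simp add: Q.G.proj_smult Psi I.G.proj_smult)
next
  case (add x y)
  then show ?case by (simp add: Q.G.proj_add Psi I.G.proj_add)
qed

lemma Psi_degree:
  assumes "x \<in> QG_deg C \<alpha>" "\<alpha> \<in> int_span (idx C)"
  shows "\<Psi> x \<in> QG_deg D (lat_incl \<alpha>)"
proof -
  have xc: "x \<in> carrier (QG C)" using assms Q.G.component_subset by blast
  have "\<Psi> x = I.deg_proj (lat_incl \<alpha>) (\<Psi> x)"
    using Psi_deg_proj[OF xc assms(2)] Q.G.proj_same[OF assms(1)] by simp
  then show ?thesis using I.G.proj_in_component[of "\<Psi> x"] Psi(1)[OF xc] by metis
qed

lemma lift_tproj:
  assumes "z \<in> carrier TQ.T" "\<alpha> \<in> int_span (idx C)" "\<beta> \<in> int_span (idx C)"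
  shows "PP.lift (TQ.tproj (\<alpha>, \<beta>) z) = TI.tproj (lat_incl \<alpha>, lat_incl \<beta>) (PP.lift z)"
  using assms(1)
proof (induction z rule: TQ.tensor_induct)
  case (pure a b)
  then show ?case
    by (simp add: TQ.tproj_tensor TI.tproj_tensor PP.lift_tensor Psi(1)
        Psi_deg_proj[OF _ assms(2)] Psi_deg_proj[OF _ assms(3)])
next
  case (add x y)
  then show ?case
    by (simp add: TQ.T.proj_add TI.T.proj_add PP.lift_add)
qed

lemma lift_mult:
  assumes "x \<in> carrier TQ.T" "y \<in> carrier TQ.T"
  shows "PP.lift (x \<otimes>\<^bsub>TQ.T\<^esub> y) = PP.lift x \<otimes>\<^bsub>TI.T\<^esub> PP.lift y"
  using assms(1)
proof (induction x rule: TQ.tensor_induct)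
  case (pure a b)
  show ?case using assms(2)
  proof (induction y rule: TQ.tensor_induct)
    case (pure c d)
    then show ?case
      by (simp add: TQ.tensor_mult TI.tensor_mult PP.lift_tensor Psi \<open>a \<in> _\<close> \<open>b \<in> _\<close>)
  next
    case (add x y)
    then show ?case
      by (simp add: PP.lift_add TQ.T.r_distr TI.T.r_distr \<open>a \<in> _\<close> \<open>b \<in> _\<close>)
  qed
next
  case (add x x')
  then show ?case using assms(2) by (simp add: PP.lift_add TQ.T.l_distr TI.T.l_distr)
qed

lemma lift_one: "PP.lift \<one>\<^bsub>TQ.T\<^esub> = \<one>\<^bsub>TI.T\<^esub>"
  by (simp add: TQ.tensor_one TI.tensor_one PP.lift_tensor Psi(4))

text \<open>A filtration of the tensor product by the imbalance of the first tensor factor, with the sign of \<open>\<epsilon>\<close> so that all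
cross terms have level one.  The two bounds that matter are \<open>0\<close>, which contains the image of
\<open>\<Psi> \<otimes> \<Psi>\<close>, and \<open>1\<close>, which contains the errors and is absorbed by multiplication with level \<open>0\<close>.\<close>

inductive_set filt :: "int \<Rightarrow> (('i, 'y) qgrp \<times> ('i, 'y) qgrp \<Rightarrow>\<^sub>0 qv) set set" for n :: int where
  zero: "\<zero>\<^bsub>TI.T\<^esub> \<in> filt n"
| pure: "a \<in> QG_deg D \<alpha> \<Longrightarrow> n \<le> \<epsilon> * imbalance \<alpha> \<Longrightarrow> b \<in> carrier (QG D) \<Longrightarrow> tensor (QG D) (QG D) a b \<in> filt n"
| add: "x \<in> filt n \<Longrightarrow> y \<in> filt n \<Longrightarrow> x \<oplus>\<^bsub>TI.T\<^esub> y \<in> filt n"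

lemma QG_degD: "a \<in> QG_deg D \<alpha> \<Longrightarrow> a \<in> carrier (QG D)"
  using I.G.component_subset by blast

lemma filt_carrier: "x \<in> filt n \<Longrightarrow> x \<in> carrier TI.T"
  by (induction rule: filt.induct) (auto dest: QG_degD)

lemma filt_mono: "x \<in> filt n \<Longrightarrow> m \<le> n \<Longrightarrow> x \<in> filt m"
  by (induction rule: filt.induct) (auto intro: filt.intros)

lemma filt_smult: "x \<in> filt n \<Longrightarrow> c \<odot>\<^bsub>TI.T\<^esub> x \<in> filt n"
proof (induction rule: filt.induct)
  case (pure a \<alpha> b)
  then have "tensor (QG D) (QG D) (c \<odot>\<^bsub>QG D\<^esub> a) b \<in> filt n"
    by (intro filt.pure[of _ \<alpha>] I.QG_deg_smult)
  then show ?case using pure by (simp add: TI.tensor_smult_left QG_degD)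
qed (auto intro: filt.intros simp: TI.T.smult_r_distr filt_carrier)

lemma filt_mult:
  assumes "x \<in> filt m" "y \<in> filt n"
  shows "x \<otimes>\<^bsub>TI.T\<^esub> y \<in> filt (m + n)"
  using assms(1)
proof (induction rule: filt.induct)
  case zero
  then show ?case using assms(2) by (simp add: filt_carrier filt.zero)
next
  case (pure a \<alpha> b)
  note a = this
  then have ac: "a \<in> carrier (QG D)" by (blast dest: QG_degD)
  show ?case using assms(2)
  proof (induction rule: filt.induct)
    case zero
    show ?case using a ac by (simp add: filt.zero)
  next
    case (pure c \<gamma> d)
    have "tensor (QG D) (QG D) (a \<otimes>\<^bsub>QG D\<^esub> c) (b \<otimes>\<^bsub>QG D\<^esub> d) \<in> filt (m + n)"
      using a pure by (intro filt.pure[of _ "\<alpha> + \<gamma>"] I.QG_deg_mult) (auto simp: imbalance_add algebra_simps)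
    then show ?case using a ac pure by (simp add: TI.tensor_mult QG_degD)
  next
    case (add y y')
    then show ?case using a ac by (simp add: TI.T.r_distr filt_carrier filt.add)
  qed
next
  case (add x x')
  then show ?case using assms(2) by (simp add: TI.T.l_distr filt_carrier filt.add)
qed

text \<open>Degrees of the contracted datum have imbalance zero, so the components in question do not see terms of level one.\<close>

lemma tproj_filt:
  assumes "z \<in> filt 1" "imbalance \<alpha> = 0"
  shows "TI.tproj (\<alpha>, \<beta>) z = \<zero>\<^bsub>TI.T\<^esub>"
  using assms(1)
proof (induction rule: filt.induct)
  case (pure a \<gamma> b)
  then have "\<alpha> \<noteq> \<gamma>" using assms(2) by auto
  then show ?case using pure by (simp add: TI.tproj_tensor I.G.proj_other QG_degD)
qed (auto simp: TI.T.proj_add filt_carrier)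

text \<open>\<open>\<Psi>\<close> maps words to elements with degree in the lattice of the contracted datum, where the imbalance vanishes.\<close>

lemma lift_filt:
  assumes "z \<in> carrier TQ.T"
  shows "PP.lift z \<in> filt 0"
  using assms
proof (induction z rule: TQ.tensor_induct)
  case (pure a b)
  from pure(1) show ?case
  proof (induction a rule: Q.QG_word_induct)
    case (word w c)
    have cw: "Q.cl (word w) \<in> carrier (QG C)" using word by (auto intro: Q.class_closed)
    have "tensor (QG D) (QG D) (c \<odot>\<^bsub>QG D\<^esub> \<Psi> (Q.cl (word w))) (\<Psi> b) \<in> filt 0"
      using pure(2) word
      by (intro filt.pure[of _ "lat_incl (word_degree w)"] I.QG_deg_smult Psi_word_degree)
        (simp_all add: imbalance_lat_incl[OF word_degree_span] Psi(1))
    then show ?case using cw pure(2) by (simp add: PP.lift_tensor Psi)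
  next
    case (add x y)
    then show ?case using pure(2) by (simp add: TQ.tensor_add_left PP.lift_add filt.add)
  qed
next
  case (add x y)
  then show ?case by (simp add: PP.lift_add filt.add)
qed

text \<open>The homomorphisms \<open>\<Delta>I \<circ> \<Psi>\<close> and \<open>(\<Psi> \<otimes> \<Psi>) \<circ> \<Delta>C\<close> agree at \<open>x\<close> up to an error of level one.  They are not
equal: at the new generators a cross term survives.\<close>

definition agrees_mod_filt :: "('i \<Rightarrow>\<^sub>0 int, 'y) qgrp \<Rightarrow> bool" where
  "agrees_mod_filt x \<longleftrightarrow> (\<exists>e\<in>filt 1. \<Delta>I (\<Psi> x) = PP.lift (\<Delta>C x) \<oplus>\<^bsub>TI.T\<^esub> e)"

lemma agrees_mod_filtI: "\<Delta>I (\<Psi> x) = PP.lift (\<Delta>C x) \<Longrightarrow> x \<in> carrier (QG C) \<Longrightarrow> agrees_mod_filt x"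
  unfolding agrees_mod_filt_def by (intro bexI[of _ "\<zero>\<^bsub>TI.T\<^esub>"] filt.zero) (simp add: DeltaC)

lemma agrees_mod_filt_add:
  assumes "agrees_mod_filt x" "agrees_mod_filt y" and c: "x \<in> carrier (QG C)" "y \<in> carrier (QG C)"
  shows "agrees_mod_filt (x \<oplus>\<^bsub>QG C\<^esub> y)"
proof -
  obtain e e' where e: "e \<in> filt 1" "e' \<in> filt 1"
    "\<Delta>I (\<Psi> x) = PP.lift (\<Delta>C x) \<oplus>\<^bsub>TI.T\<^esub> e" "\<Delta>I (\<Psi> y) = PP.lift (\<Delta>C y) \<oplus>\<^bsub>TI.T\<^esub> e'"
    using assms by (auto simp: agrees_mod_filt_def)
  then have "\<Delta>I (\<Psi> (x \<oplus>\<^bsub>QG C\<^esub> y)) = PP.lift (\<Delta>C (x \<oplus>\<^bsub>QG C\<^esub> y)) \<oplus>\<^bsub>TI.T\<^esub> (e \<oplus>\<^bsub>TI.T\<^esub> e')"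
    using c by (simp add: Psi DeltaI DeltaC PP.lift_add filt_carrier TI.T.a_ac)
  then show ?thesis using e by (auto simp: agrees_mod_filt_def intro: filt.add)
qed

lemma agrees_mod_filt_smult:
  assumes "agrees_mod_filt x" and c: "x \<in> carrier (QG C)"
  shows "agrees_mod_filt (c \<odot>\<^bsub>QG C\<^esub> x)"
proof -
  obtain e where e: "e \<in> filt 1" "\<Delta>I (\<Psi> x) = PP.lift (\<Delta>C x) \<oplus>\<^bsub>TI.T\<^esub> e"
    using assms by (auto simp: agrees_mod_filt_def)
  then have "\<Delta>I (\<Psi> (c \<odot>\<^bsub>QG C\<^esub> x)) = PP.lift (\<Delta>C (c \<odot>\<^bsub>QG C\<^esub> x)) \<oplus>\<^bsub>TI.T\<^esub> c \<odot>\<^bsub>TI.T\<^esub> e"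
    using c by (simp add: Psi DeltaI DeltaC PP.lift_smult filt_carrier TI.T.smult_r_distr)
  then show ?thesis using e by (auto simp: agrees_mod_filt_def intro: filt_smult)
qed

text \<open>With errors \<open>e\<close>, \<open>e'\<close> the product has error \<open>x e' + e y + e e'\<close>, which has level one because the values \<open>x\<close>, \<open>y\<close>
of \<open>(\<Psi> \<otimes> \<Psi>) \<circ> \<Delta>C\<close> have level zero.\<close>

lemma agrees_mod_filt_mult:
  assumes "agrees_mod_filt x" "agrees_mod_filt y" and c: "x \<in> carrier (QG C)" "y \<in> carrier (QG C)"
  shows "agrees_mod_filt (x \<otimes>\<^bsub>QG C\<^esub> y)"
proof -
  obtain e e' where e: "e \<in> filt 1" "e' \<in> filt 1"
    "\<Delta>I (\<Psi> x) = PP.lift (\<Delta>C x) \<oplus>\<^bsub>TI.T\<^esub> e" "\<Delta>I (\<Psi> y) = PP.lift (\<Delta>C y) \<oplus>\<^bsub>TI.T\<^esub> e'"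
    using assms by (auto simp: agrees_mod_filt_def)
  let ?x = "PP.lift (\<Delta>C x)" and ?y = "PP.lift (\<Delta>C y)"
  let ?d = "?x \<otimes>\<^bsub>TI.T\<^esub> e' \<oplus>\<^bsub>TI.T\<^esub> (e \<otimes>\<^bsub>TI.T\<^esub> ?y \<oplus>\<^bsub>TI.T\<^esub> e \<otimes>\<^bsub>TI.T\<^esub> e')"
  have f: "?x \<in> filt 0" "?y \<in> filt 0" using c by (auto intro!: lift_filt DeltaC(1))
  have "?x \<otimes>\<^bsub>TI.T\<^esub> e' \<in> filt 1" "e \<otimes>\<^bsub>TI.T\<^esub> ?y \<in> filt 1" "e \<otimes>\<^bsub>TI.T\<^esub> e' \<in> filt 1"
    using filt_mult[OF f(1) e(2)] filt_mult[OF e(1) f(2)] filt_mult[OF e(1) e(2)]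
    by (auto intro: filt_mono)
  then have "?d \<in> filt 1" by (intro filt.add)
  moreover have "\<Delta>I (\<Psi> (x \<otimes>\<^bsub>QG C\<^esub> y)) = PP.lift (\<Delta>C (x \<otimes>\<^bsub>QG C\<^esub> y)) \<oplus>\<^bsub>TI.T\<^esub> ?d"
    using c e filt_carrier[OF e(1)] filt_carrier[OF e(2)] filt_carrier[OF f(1)] filt_carrier[OF f(2)]
    by (simp add: Psi DeltaI DeltaC lift_mult TI.T.l_distr TI.T.r_distr TI.T.a_ac)
  ultimately show ?thesis by (auto simp: agrees_mod_filt_def)
qed

lemma DeltaI_gens:
  "i \<in> idx D \<Longrightarrow> \<Delta>I (I.E i) = TI.tens (I.E i) \<one>\<^bsub>QG D\<^esub> \<oplus>\<^bsub>TI.T\<^esub> TI.tens (I.K (scaled_coroot D i)) (I.E i)"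
  "i \<in> idx D \<Longrightarrow> \<Delta>I (I.F i) = TI.tens (I.F i) (I.K (- scaled_coroot D i)) \<oplus>\<^bsub>TI.T\<^esub> TI.tens \<one>\<^bsub>QG D\<^esub> (I.F i)"
  "\<Delta>I (I.K \<mu>) = TI.tens (I.K \<mu>) (I.K \<mu>)"
  using comult_I unfolding is_comult_def Let_def by blast+

lemma DeltaC_gens:
  "i \<in> idx C \<Longrightarrow> \<Delta>C (Q.E i) = TQ.tens (Q.E i) \<one>\<^bsub>QG C\<^esub> \<oplus>\<^bsub>TQ.T\<^esub> TQ.tens (Q.K (scaled_coroot C i)) (Q.E i)"
  "i \<in> idx C \<Longrightarrow> \<Delta>C (Q.F i) = TQ.tens (Q.F i) (Q.K (- scaled_coroot C i)) \<oplus>\<^bsub>TQ.T\<^esub> TQ.tens \<one>\<^bsub>QG C\<^esub> (Q.F i)"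
  "\<Delta>C (Q.K \<mu>) = TQ.tens (Q.K \<mu>) (Q.K \<mu>)"
  using comult_C unfolding is_comult_def Let_def by blast+

lemma lift_DeltaC_gens:
  "i \<in> idx C \<Longrightarrow> PP.lift (\<Delta>C (Q.E i)) = TI.tens (\<Psi> (Q.E i)) \<one>\<^bsub>QG D\<^esub> \<oplus>\<^bsub>TI.T\<^esub> TI.tens (I.K (scaled_coroot C i)) (\<Psi> (Q.E i))"
  "i \<in> idx C \<Longrightarrow> PP.lift (\<Delta>C (Q.F i)) = TI.tens (\<Psi> (Q.F i)) (I.K (- scaled_coroot C i)) \<oplus>\<^bsub>TI.T\<^esub> TI.tens \<one>\<^bsub>QG D\<^esub> (\<Psi> (Q.F i))"
  "PP.lift (\<Delta>C (Q.K \<mu>)) = TI.tens (I.K \<mu>) (I.K \<mu>)"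
  by (simp_all add: DeltaC_gens PP.lift_add PP.lift_tensor generator_images Psi(4))

lemma agrees_mod_filt_old_gens:
  "i \<in> idx D - {ip, im} \<Longrightarrow> agrees_mod_filt (Q.E (frag_of i))"
  "i \<in> idx D - {ip, im} \<Longrightarrow> agrees_mod_filt (Q.F (frag_of i))"
  "agrees_mod_filt (Q.K \<mu>)"
  by (rule agrees_mod_filtI; simp add: idx_C lift_DeltaC_gens DeltaI_gens generator_images scaled_coroot_C)+

lemma i0_in [simp]: "i0 \<in> idx C"
  by (simp add: idx_C)

lemma vanishing_scalars:
  "\<epsilon> = 1 \<Longrightarrow> twist - vv powi (- (\<epsilon> * half)) = 0" "\<epsilon> = 1 \<Longrightarrow> 1 - vv powi (\<epsilon> * half) * twist = 0"
  "\<epsilon> = -1 \<Longrightarrow> 1 - vv powi (- (\<epsilon> * half)) * twist = 0" "\<epsilon> = -1 \<Longrightarrow> twist - vv powi (\<epsilon> * half) = 0"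
  by (simp_all add: power_int_add[symmetric])

lemma imbalance_ends: "imbalance (frag_of ip) = 1" "imbalance (frag_of im) = -1"
  "imbalance (- frag_of ip) = -1" "imbalance (- frag_of im) = 1"
  by (simp_all add: imbalance_def lookup_frag_of)

text \<open>For \<open>\<epsilon> = 1\<close> the surviving cross term is a multiple of \<open>E\<^sub>+ K\<^sub>- \<otimes> E\<^sub>-\<close>, and for \<open>\<epsilon> = -1\<close> of \<open>E\<^sub>- K\<^sub>+ \<otimes> E\<^sub>+\<close>.  The
first factor has imbalance \<open>\<epsilon>\<close> in both cases.\<close>

lemma agrees_mod_filt_E0: "agrees_mod_filt (Q.E i0)"
proof -
  let ?U = "QG D" and ?q = "vv powi (- (\<epsilon> * half))"
  let ?k = "I.K (scaled_coroot D ip)" and ?l = "I.K (scaled_coroot D im)"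
  let ?e = "(1 - ?q * twist) \<odot>\<^bsub>TI.T\<^esub> TI.tens (I.E ip \<otimes>\<^bsub>?U\<^esub> ?l) (I.E im) \<oplus>\<^bsub>TI.T\<^esub>
      (twist - ?q) \<odot>\<^bsub>TI.T\<^esub> TI.tens (I.E im \<otimes>\<^bsub>?U\<^esub> ?k) (I.E ip)"
  have deg: "I.E i \<otimes>\<^bsub>?U\<^esub> I.K \<mu> \<in> QG_deg D (frag_of i)" if "i \<in> idx D" for i \<mu>
    using I.QG_deg_mult[OF I.E_degree[OF that] I.K_degree] by simp
  have "\<Delta>I (\<Psi> (Q.E i0)) = PP.lift (\<Delta>C (Q.E i0)) \<oplus>\<^bsub>TI.T\<^esub> ?e"
    using I.U.tensor_commutator_left[of "I.E ip" "I.E im" ?k ?l twist coeffE ?q]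
    by (simp add: Psi_E0 lift_DeltaC_gens DeltaI DeltaI_gens scaled_coroot_C I.K_add I.K_E
        pairing_scaled_ends add.commute)
  moreover have "?e \<in> filt 1"
  proof (cases "\<epsilon> = 1")
    case True
    have "TI.tens (I.E ip \<otimes>\<^bsub>?U\<^esub> ?l) (I.E im) \<in> filt 1"
      using True by (intro filt.pure[of _ "frag_of ip"] deg) (simp_all add: imbalance_ends)
    then show ?thesis unfolding vanishing_scalars(1)[OF True] using filt_smult by (simp add: filt_carrier)
  next
    case False
    then have e: "\<epsilon> = -1" using eps by simp
    have "TI.tens (I.E im \<otimes>\<^bsub>?U\<^esub> ?k) (I.E ip) \<in> filt 1"
      using e by (intro filt.pure[of _ "frag_of im"] deg) (simp_all add: imbalance_ends)
    then show ?thesis unfolding vanishing_scalars(3)[OF e] using filt_smult by (simp add: filt_carrier)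
  qed
  ultimately show ?thesis by (auto simp: agrees_mod_filt_def)
qed

text \<open>The image of the new \<open>F\<close> starts with \<open>F\<^sub>- F\<^sub>+\<close> and has the inverse scalar, which makes the surviving cross
term have first factor \<open>F\<^sub>-\<close> for \<open>\<epsilon> = 1\<close> and \<open>F\<^sub>+\<close> for \<open>\<epsilon> = -1\<close>: as \<open>F\<close> has negative degree, the imbalance is
\<open>\<epsilon>\<close> again.\<close>

lemma agrees_mod_filt_F0: "agrees_mod_filt (Q.F i0)"
proof -
  let ?U = "QG D" and ?q = "vv powi (\<epsilon> * half)"
  let ?k = "I.K (- scaled_coroot D im)" and ?l = "I.K (- scaled_coroot D ip)"
  let ?e = "(1 - ?q * twist) \<odot>\<^bsub>TI.T\<^esub> TI.tens (I.F ip) (I.F im \<otimes>\<^bsub>?U\<^esub> ?l) \<oplus>\<^bsub>TI.T\<^esub>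
      (twist - ?q) \<odot>\<^bsub>TI.T\<^esub> TI.tens (I.F im) (I.F ip \<otimes>\<^bsub>?U\<^esub> ?k)"
  have "\<Delta>I (\<Psi> (Q.F i0)) = PP.lift (\<Delta>C (Q.F i0)) \<oplus>\<^bsub>TI.T\<^esub> ?e"
    using I.U.tensor_commutator_right[of "I.F im" "I.F ip" ?k ?l twist coeffF ?q]
    by (simp add: Psi_F0 lift_DeltaC_gens DeltaI DeltaI_gens scaled_coroot_C I.K_add I.K_F
        pairing_minus pairing_scaled_ends add.commute)
  moreover have "?e \<in> filt 1"
  proof (cases "\<epsilon> = 1")
    case True
    have "TI.tens (I.F im) (I.F ip \<otimes>\<^bsub>?U\<^esub> ?k) \<in> filt 1"
      using True by (intro filt.pure[of _ "- frag_of im"] I.F_degree) (simp_all add: imbalance_ends)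
    then show ?thesis unfolding vanishing_scalars(2)[OF True] using filt_smult by (simp add: filt_carrier)
  next
    case False
    then have e: "\<epsilon> = -1" using eps by simp
    have "TI.tens (I.F ip) (I.F im \<otimes>\<^bsub>?U\<^esub> ?l) \<in> filt 1"
      using e by (intro filt.pure[of _ "- frag_of ip"] I.F_degree) (simp_all add: imbalance_ends)
    then show ?thesis unfolding vanishing_scalars(4)[OF e] using filt_smult by (simp add: filt_carrier)
  qed
  ultimately show ?thesis by (auto simp: agrees_mod_filt_def)
qed

lemma agrees_mod_filt_word:
  assumes "w \<in> Q.W" shows "agrees_mod_filt (Q.cl (word w))"
  using assms
proof (induction rule: Q.word_induct)
  case one
  show ?case by (rule agrees_mod_filtI) (simp_all add: Psi(4) DeltaI(4) DeltaC(4) lift_one)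
next
  case (gen g w)
  have "agrees_mod_filt (Q.cl (word [g]))"
  proof -
    consider i where "i \<in> idx D - {ip, im}" "g = GE (frag_of i)" | "g = GE i0"
      | i where "i \<in> idx D - {ip, im}" "g = GF (frag_of i)" | "g = GF i0" | \<mu> where "g = GK \<mu>"
      using gen by (auto simp: gens_def idx_C)
    then show ?thesis
      by cases (use agrees_mod_filt_old_gens agrees_mod_filt_E0 agrees_mod_filt_F0 in
        \<open>simp_all add: Egen_def[symmetric] Fgen_def[symmetric] Kgen_def[symmetric]\<close>)
  qed
  then show ?case using gen by (intro agrees_mod_filt_mult) (auto intro!: Q.class_closed)
qed

lemma agrees_mod_filt_all: "x \<in> carrier (QG C) \<Longrightarrow> agrees_mod_filt x"
proof (induction x rule: Q.QG_word_induct)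
  case (word w c)
  then show ?case by (intro agrees_mod_filt_smult agrees_mod_filt_word) (auto intro!: Q.class_closed)
qed (rule agrees_mod_filt_add)

text \<open>Both sides are the component at \<open>(\<tau>, \<omega>)\<close> of one element, \<open>\<Psi> \<otimes> \<Psi>\<close> applied to the coproduct of \<open>x\<close>: on the left the
error is killed, on the right projection and \<open>\<Psi> \<otimes> \<Psi>\<close> are interchanged.\<close>

lemma components_agree:
  assumes \<nu>: "\<nu> \<in> int_span (idx C)" and \<tau>: "\<tau> \<in> int_span (idx C)" and \<omega>: "\<omega> \<in> int_span (idx C)"
    and x: "x \<in> QG_deg C \<nu>"
  shows "comult_comp D \<Delta>I (lat_incl \<nu>) (lat_incl \<tau>) (lat_incl \<omega>) (\<Psi> x) =
    tensor_map (QG C) (QG C) (QG D) (QG D) (QG_deg C \<tau>) (QG_deg C \<omega>)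
              (restrict \<Psi> (QG_deg C \<tau>)) (restrict \<Psi> (QG_deg C \<omega>)) (comult_comp C \<Delta>C \<nu> \<tau> \<omega> x)"
proof -
  have xc: "x \<in> carrier (QG C)" using x Q.G.component_subset by blast
  obtain e where e: "e \<in> filt 1" "\<Delta>I (\<Psi> x) = PP.lift (\<Delta>C x) \<oplus>\<^bsub>TI.T\<^esub> e"
    using agrees_mod_filt_all[OF xc] by (auto simp: agrees_mod_filt_def)
  have C: "comult_comp C \<Delta>C \<nu> \<tau> \<omega> x = TQ.tproj (\<tau>, \<omega>) (\<Delta>C x)"
    using x xc by (simp add: comult_comp_def TQ.T.direct_sum_proj_eq DeltaC)
  have sub: "TQ.tproj (\<tau>, \<omega>) (\<Delta>C x) \<in> tensor_subspace (QG C) (QG C) (QG_deg C \<tau>) (QG_deg C \<omega>)"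
    using TQ.T.proj_in_component[of "\<Delta>C x" "(\<tau>, \<omega>)"] xc by (simp add: DeltaC)
  have "comult_comp D \<Delta>I (lat_incl \<nu>) (lat_incl \<tau>) (lat_incl \<omega>) (\<Psi> x)
      = TI.tproj (lat_incl \<tau>, lat_incl \<omega>) (\<Delta>I (\<Psi> x))"
    using Psi_degree[OF x \<nu>] xc by (simp add: comult_comp_def TI.T.direct_sum_proj_eq DeltaI Psi)
  also have "\<dots> = TI.tproj (lat_incl \<tau>, lat_incl \<omega>) (PP.lift (\<Delta>C x))"
    using e xc tproj_filt[OF e(1) imbalance_lat_incl[OF \<tau>]]
    by (simp add: TI.T.proj_add filt_carrier DeltaC)
  also have "\<dots> = PP.lift (TQ.tproj (\<tau>, \<omega>) (\<Delta>C x))"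
    using xc \<tau> \<omega> by (simp add: lift_tproj DeltaC)
  also have "\<dots> = tensor_map (QG C) (QG C) (QG D) (QG D) (QG_deg C \<tau>) (QG_deg C \<omega>)
              (restrict \<Psi> (QG_deg C \<tau>)) (restrict \<Psi> (QG_deg C \<omega>)) (TQ.tproj (\<tau>, \<omega>) (\<Delta>C x))"
    by (rule tensor_map_eq_lift[symmetric])
      (use PP.tensor_functor_axioms Q.G.component_subset sub in auto)
  finally show ?thesis by (simp add: C)
qed

end

theorem proposition4p4p1:
  fixes D :: "('i, 'y::ab_group_add, 'x::ab_group_add) datum"
    and ip im :: 'i
    and \<epsilon> :: int
    and \<Delta>I :: "('i, 'y) qgrp \<Rightarrow> (('i, 'y) qgrp \<times> ('i, 'y) qgrp \<Rightarrow>\<^sub>0 qv) set"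
    and \<Delta>C :: "('i \<Rightarrow>\<^sub>0 int, 'y) qgrp \<Rightarrow>
                   (('i \<Rightarrow>\<^sub>0 int, 'y) qgrp \<times> ('i \<Rightarrow>\<^sub>0 int, 'y) qgrp \<Rightarrow>\<^sub>0 qv) set"
    and \<Psi> :: "('i \<Rightarrow>\<^sub>0 int, 'y) qgrp \<Rightarrow> ('i, 'y) qgrp"
    and \<nu> \<tau> \<omega> :: "('i \<Rightarrow>\<^sub>0 int) \<Rightarrow>\<^sub>0 int"
  defines "C \<equiv> contraction D ip im"
  assumes "root_datum D"
    and "contractible_edge D ip im"
    and "\<epsilon> \<in> {1, -1}"
    and "is_comult D \<Delta>I"
    and "is_comult C \<Delta>C"
    and "is_contraction_hom D ip im \<epsilon> \<Psi>"
    and "\<nu> \<in> int_span (idx C)" and "\<tau> \<in> int_span (idx C)" and "\<omega> \<in> int_span (idx C)"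
    and "\<tau> + \<omega> = \<nu>"
  shows "compose (QG_deg C \<nu>)
           (comult_comp D \<Delta>I (lat_incl \<nu>) (lat_incl \<tau>) (lat_incl \<omega>))
           (restrict \<Psi> (QG_deg C \<nu>))
       = compose (QG_deg C \<nu>)
           (tensor_map (QG C) (QG C) (QG D) (QG D) (QG_deg C \<tau>) (QG_deg C \<omega>)
              (restrict \<Psi> (QG_deg C \<tau>)) (restrict \<Psi> (QG_deg C \<omega>)))
           (comult_comp C \<Delta>C \<nu> \<tau> \<omega>)"
proof -
  interpret contraction_hom D ip im \<epsilon> \<Delta>I \<Delta>C \<Psi>
    using assms by unfold_locales (simp_all add: C_def)
  show ?thesis
    unfolding compose_def
    by (rule restrict_ext) (use assms(8-10) components_agree in \<open>simp add: C_def\<close>)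
qed

end
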